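(* Let $(M,F)$ be a regular AR-Finsler manifold of dimension $n\geq 2$, with $g_{ij}(x,y)=\eta(x,y)\,a_{ij}(x,y)$. Then a necessary and sufficient condition for $(M,F)$ to be Riemannian is that, for all $i=1,\dots,n$, $$a^{jk}\left(n\,\dot{\partial}_k a_{ji}-\dot{\partial}_i a_{jk}\right)=0.$$
   Context: $M$ is a smooth $n$-dimensional manifold with local coordinates $(x^i)$ and induced fibre coordinates $(y^i)$ on $TM$; $\partial_i=\partial/\partial x^i$, $\dot{\partial}_i=\partial/\partial y^i$; the summation convention is used. A (regular) Finsler metric on $M$ is a map $F:TM\to[0,\infty)$ which is $C^\infty$ on $TM\setminus\{0\}$, positively homogeneous of degree one in $y$, and such that $g_{ij}(x,y):=\frac12\dot{\partial}_i\dot{\partial}_jF^2$ is positive definite at each point of $TM\setminus\{0\}$; $(g^{ij})$ is the inverse matrix. "Rational in $y$" means: locally in $x$, a quotient of two polynomials in $y$ whose coefficients are smooth functions of $x$. $F$ is an AR-Finsler metric (and $(M,F)$ an AR-Finsler manifold) if $g_{ij}(x,y)=\eta(x,y)\,a_{ij}(x,y)$ where (a) $\eta:TM\setminus\{0\}\to[0,\infty)$ is smooth; (b) $(a_{ij}(x,y))$ is a symmetric positive definite matrix with each $a_{ij}$ rational in $y$; (c) each product $\eta\,a_{ij}$ is positively homogeneous of degree zero in $y$. Such a decomposition is fixed, and $(a^{ij})$ is the inverse matrix of $(a_{ij})$. The Cartan torsion is $C_{ijk}=\frac12\dot{\partial}_kg_{ij}$; $(M,F)$ is Riemannian if and only if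 $C_{ijk}=0$ identically. *)

theory Defs
  imports "HOL-Analysis.Analysis"
begin

section \<open>Smooth maps between open subsets of normed spaces\<close>

text \<open>Both notions are meant for open \<open>S\<close> only.\<close>

primrec C_k_on :: "nat \<Rightarrow> 'a::real_normed_vector set \<Rightarrow> ('a \<Rightarrow> 'b::real_normed_vector) \<Rightarrow> bool" where
  "C_k_on 0 S f \<longleftrightarrow> continuous_on S f"
| "C_k_on (Suc k) S f \<longleftrightarrow>
     (\<forall>x\<in>S. f differentiable (at x)) \<and> (\<forall>v. C_k_on k S (\<lambda>x. frechet_derivative f (at x) v))"

definition smooth_on :: "'a::real_normed_vector set \<Rightarrow> ('a \<Rightarrow> 'b::real_normed_vector) \<Rightarrow> bool" where
  "smooth_on S f \<longleftrightarrow> (\<forall>k. C_k_on k S f)"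

definition partial :: "'n \<Rightarrow> (real^'n \<Rightarrow> real) \<Rightarrow> real^'n \<Rightarrow> real" where
  "partial i f y = frechet_derivative f (at y) (axis i 1)"

definition pos_def_matrix :: "real^'n^'n \<Rightarrow> bool" where
  "pos_def_matrix A \<longleftrightarrow> transpose A = A \<and> (\<forall>v. v \<noteq> 0 \<longrightarrow> 0 < v \<bullet> (A *v v))"

section \<open>Smooth manifolds and their tangent bundles\<close>

text \<open>A chart is a pair of its domain and its coordinate map; the values of the coordinate map
  outside the domain are irrelevant.\<close>

type_synonym ('m, 'n) chart = "'m set \<times> ('m \<Rightarrow> real^'n)"

abbreviation chart_image :: "('m, 'n::finite) chart \<Rightarrow> (real^'n) set" where
  "chart_image c \<equiv> snd c ` fst c"

abbreviation chart_inv :: "('m, 'n::finite) chart \<Rightarrow> real^'n \<Rightarrow> 'm" where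
  "chart_inv c \<equiv> inv_into (fst c) (snd c)"

definition is_chart :: "'m topology \<Rightarrow> ('m, 'n::finite) chart \<Rightarrow> bool" where
  "is_chart M c \<longleftrightarrow> openin M (fst c) \<and> open (chart_image c) \<and>
     homeomorphic_map (subtopology M (fst c)) (top_of_set (chart_image c)) (snd c)"

definition transition :: "('m, 'n::finite) chart \<Rightarrow> ('m, 'n::finite) chart \<Rightarrow> real^'n \<Rightarrow> real^'n" where
  "transition c d = snd d \<circ> chart_inv c"

text \<open>\<open>A\<close> may be any smooth atlas, in particular the maximal one; the dimension is \<open>CARD('n)\<close>.\<close>

definition smooth_manifold :: "'m topology \<Rightarrow> ('m, 'n::finite) chart set \<Rightarrow> bool" where
  "smooth_manifold M A \<longleftrightarrow> Hausdorff_space M \<and> second_countable M \<and>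
     (\<forall>c\<in>A. is_chart M c) \<and> (\<Union>c\<in>A. fst c) = topspace M \<and>
     (\<forall>c\<in>A. \<forall>d\<in>A. smooth_on (snd c ` (fst c \<inter> fst d)) (transition c d))"

text \<open>A tangent vector is a base point together with the family of its components in the charts
  around that point, subject to the contravariant transformation law. Components with respect to
  irrelevant charts are normalised to \<open>0\<close>, so that tangent vectors are equal iff they have the same
  base point and the same components.\<close>

type_synonym ('m, 'n) tvector = "'m \<times> (('m, 'n) chart \<Rightarrow> real^'n)"

definition TM :: "'m topology \<Rightarrow> ('m, 'n::finite) chart set \<Rightarrow> ('m, 'n::finite) tvector set" where
  "TM M A = {(p, v). p \<in> topspace M \<and> (\<forall>c. c \<notin> A \<or> p \<notin> fst c \<longrightarrow> v c = 0) \<and>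
     (\<forall>c\<in>A. \<forall>d\<in>A. p \<in> fst c \<and> p \<in> fst d \<longrightarrow>
        v d = frechet_derivative (transition c d) (at (snd c p)) (v c))}"

definition slit_TM :: "'m topology \<Rightarrow> ('m, 'n::finite) chart set \<Rightarrow> ('m, 'n::finite) tvector set" where
  "slit_TM M A = {v \<in> TM M A. snd v \<noteq> (\<lambda>_. 0)}"

definition scale_tvector :: "real \<Rightarrow> ('m, 'n::finite) tvector \<Rightarrow> ('m, 'n::finite) tvector" where
  "scale_tvector t v = (fst v, \<lambda>c. t *\<^sub>R snd v c)"

text \<open>The tangent vector with induced coordinates \<open>(x, y)\<close> in the chart \<open>c\<close>
  (see \<open>tvec_in_TM\<close> and \<open>tvec_components\<close> below).\<close>

definition tvec :: "('m, 'n::finite) chart set \<Rightarrow> ('m, 'n::finite) chart \<Rightarrow> real^'n \<Rightarrow> real^'n \<Rightarrow> ('m, 'n::finite) tvector" where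
  "tvec A c x y = (chart_inv c x,
     \<lambda>d. if d \<in> A \<and> chart_inv c x \<in> fst d then frechet_derivative (transition c d) (at x) y else 0)"

definition smooth_on_slit_TM :: "('m, 'n::finite) chart set \<Rightarrow> (('m, 'n::finite) tvector \<Rightarrow> real) \<Rightarrow> bool" where
  "smooth_on_slit_TM A f \<longleftrightarrow>
     (\<forall>c\<in>A. smooth_on (chart_image c \<times> (- {0})) (\<lambda>(x, y). f (tvec A c x y)))"

section \<open>Finsler and Riemannian metrics\<close>

definition fund_tensor ::
  "('m, 'n::finite) chart set \<Rightarrow> (('m, 'n::finite) tvector \<Rightarrow> real) \<Rightarrow> ('m, 'n::finite) chart \<Rightarrow> real^'n \<Rightarrow> real^'n \<Rightarrow> real^'n^'n"
  where
  "fund_tensor A F c x y =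
     (\<chi> i j. 1/2 * partial i (partial j (\<lambda>z. (F (tvec A c x z))\<^sup>2)) y)"

definition finsler_metric ::
  "'m topology \<Rightarrow> ('m, 'n::finite) chart set \<Rightarrow> (('m, 'n::finite) tvector \<Rightarrow> real) \<Rightarrow> bool" where
  "finsler_metric M A F \<longleftrightarrow>
     (\<forall>v\<in>TM M A. 0 \<le> F v) \<and>
     smooth_on_slit_TM A F \<and>
     (\<forall>v\<in>TM M A. \<forall>t>0. F (scale_tvector t v) = t * F v) \<and>
     (\<forall>c\<in>A. \<forall>x\<in>chart_image c. \<forall>y. y \<noteq> 0 \<longrightarrow> pos_def_matrix (fund_tensor A F c x y))"

text \<open>A Riemannian metric is given as a function of two tangent vectors with a common base point;
  its values on other pairs are irrelevant.\<close>

definition riemannian_metric ::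
  "('m, 'n::finite) chart set \<Rightarrow> (('m, 'n::finite) tvector \<Rightarrow> ('m, 'n::finite) tvector \<Rightarrow> real) \<Rightarrow> bool" where
  "riemannian_metric A h \<longleftrightarrow>
     (\<forall>c\<in>A. \<exists>H. smooth_on (chart_image c) H \<and>
        (\<forall>x\<in>chart_image c. pos_def_matrix (H x) \<and>
           (\<forall>y z. h (tvec A c x y) (tvec A c x z) = y \<bullet> (H x *v z))))"

definition is_riemannian ::
  "'m topology \<Rightarrow> ('m, 'n::finite) chart set \<Rightarrow> (('m, 'n::finite) tvector \<Rightarrow> real) \<Rightarrow> bool" where
  "is_riemannian M A F \<longleftrightarrow> (\<exists>h. riemannian_metric A h \<and> (\<forall>v\<in>TM M A. F v = sqrt (h v v)))"

section \<open>AR-Finsler metrics\<close>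

text \<open>Polynomials in \<open>y\<close> with coefficients smooth in \<open>x \<in> V\<close>; \<open>E\<close> is a finite set of
  multi-indices.\<close>

definition fibre_polynomial :: "(real^'n) set \<Rightarrow> (real^'n \<Rightarrow> real^'n \<Rightarrow> real) \<Rightarrow> bool" where
  "fibre_polynomial V f \<longleftrightarrow>
     (\<exists>(E :: ('n \<Rightarrow> nat) set) p. finite E \<and> (\<forall>e\<in>E. smooth_on V (p e)) \<and>
        (\<forall>x\<in>V. \<forall>y. f x y = (\<Sum>e\<in>E. p e x * (\<Prod>i\<in>UNIV. (y $ i) ^ e i))))"

definition fibre_rational :: "(real^'n) set \<Rightarrow> (real^'n \<Rightarrow> real^'n \<Rightarrow> real) \<Rightarrow> bool" where
  "fibre_rational D f \<longleftrightarrow>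
     (\<forall>x\<^sub>0\<in>D. \<exists>V P Q. open V \<and> x\<^sub>0 \<in> V \<and> V \<subseteq> D \<and> fibre_polynomial V P \<and> fibre_polynomial V Q \<and>
        (\<forall>x\<in>V. \<forall>y. y \<noteq> 0 \<longrightarrow> Q x y \<noteq> 0 \<and> f x y = P x y / Q x y))"

text \<open>\<open>a c x y\<close> is the matrix of the \<open>a\<^sub>i\<^sub>j\<close> in the induced coordinates of the chart \<open>c\<close>; its values
  matter only for \<open>x\<close> in the image of \<open>c\<close> and \<open>y \<noteq> 0\<close>.\<close>

definition AR_decomposition ::
  "'m topology \<Rightarrow> ('m, 'n::finite) chart set \<Rightarrow> (('m, 'n::finite) tvector \<Rightarrow> real) \<Rightarrow> (('m, 'n::finite) tvector \<Rightarrow> real) \<Rightarrow>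
   (('m, 'n::finite) chart \<Rightarrow> real^'n \<Rightarrow> real^'n \<Rightarrow> real^'n^'n) \<Rightarrow> bool" where
  "AR_decomposition M A F \<eta> a \<longleftrightarrow>
     (\<forall>c\<in>A. \<forall>x\<in>chart_image c. \<forall>y. y \<noteq> 0 \<longrightarrow>
        fund_tensor A F c x y = \<eta> (tvec A c x y) *\<^sub>R a c x y) \<and>
     (\<forall>v\<in>slit_TM M A. 0 \<le> \<eta> v) \<and> smooth_on_slit_TM A \<eta> \<and>
     (\<forall>c\<in>A. (\<forall>x\<in>chart_image c. \<forall>y. y \<noteq> 0 \<longrightarrow> pos_def_matrix (a c x y)) \<and>
        (\<forall>i j. fibre_rational (chart_image c) (\<lambda>x y. a c x y $ i $ j))) \<and>
     (\<forall>c\<in>A. \<forall>x\<in>chart_image c. \<forall>y. y \<noteq> 0 \<longrightarrow> (\<forall>t>0. \<forall>i j.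
        \<eta> (tvec A c x (t *\<^sub>R y)) * a c x (t *\<^sub>R y) $ i $ j = \<eta> (tvec A c x y) * a c x y $ i $ j))"

section \<open>Induced coordinates on the tangent bundle\<close>

lemma chart_inj: "is_chart M c \<Longrightarrow> inj_on (snd c) (fst c)"
  using openin_subset[of M "fst c"]
  by (auto simp: is_chart_def homeomorphic_eq_everything_map Int_absorb1)

lemma chart_overlap_open:
  assumes "is_chart M c" "is_chart M d"
  shows "open (snd c ` (fst c \<inter> fst d))"
proof -
  have "openin (subtopology M (fst c)) (fst c \<inter> fst d)"
    using assms by (auto simp: is_chart_def openin_subtopology)
  then have "openin (top_of_set (chart_image c)) (snd c ` (fst c \<inter> fst d))"
    using assms(1) homeomorphic_map_openness_eq unfolding is_chart_def by blast
  then show ?thesis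
    using assms(1) openin_open_trans unfolding is_chart_def by blast
qed

lemma transition_differentiable:
  assumes "smooth_manifold M A" "c \<in> A" "d \<in> A" "p \<in> fst c" "p \<in> fst d"
  shows "transition c d differentiable (at (snd c p))"
proof -
  have "C_k_on (Suc 0) (snd c ` (fst c \<inter> fst d)) (transition c d)"
    using assms unfolding smooth_manifold_def smooth_on_def by blast
  then show ?thesis using assms by auto
qed

lemma transition_deriv_compose:
  assumes M: "smooth_manifold M A" and A: "c \<in> A" "d \<in> A" "e \<in> A"
    and p: "p \<in> fst c" "p \<in> fst d" "p \<in> fst e"
  shows "frechet_derivative (transition d e) (at (snd d p))
           (frechet_derivative (transition c d) (at (snd c p)) y) =
         frechet_derivative (transition c e) (at (snd c p)) y"
proof -
  have ch: "is_chart M c" "is_chart M d" using M A unfolding smooth_manifold_def by auto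
  have inv: "chart_inv c (snd c q) = q" if "q \<in> fst c" for q
    using chart_inj[OF ch(1)] that by simp
  have inv': "chart_inv d (snd d q) = q" if "q \<in> fst d" for q
    using chart_inj[OF ch(2)] that by simp
  have cd: "transition c d (snd c p) = snd d p" using inv[OF p(1)] by (simp add: transition_def)
  have "((transition d e \<circ> transition c d) has_derivative
      (frechet_derivative (transition d e) (at (snd d p)) \<circ>
       frechet_derivative (transition c d) (at (snd c p)))) (at (snd c p))"
    using transition_differentiable[OF M A(1,2) p(1,2)] transition_differentiable[OF M A(2,3) p(2,3)]
    by (intro diff_chain_at) (simp_all add: cd frechet_derivative_works)
  then have "(transition c e has_derivative
      (frechet_derivative (transition d e) (at (snd d p)) \<circ>
       frechet_derivative (transition c d) (at (snd c p)))) (at (snd c p))"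
    by (rule has_derivative_transform_within_open[OF _ chart_overlap_open[OF ch]])
       (use p inv inv' in \<open>auto simp: transition_def\<close>)
  from fun_cong[OF frechet_derivative_at[OF this], of y] show ?thesis by simp
qed

lemma transition_deriv_self:
  assumes M: "smooth_manifold M A" and c: "c \<in> A" "p \<in> fst c"
  shows "frechet_derivative (transition c c) (at (snd c p)) y = y"
proof -
  have ch: "is_chart M c" using M c unfolding smooth_manifold_def by auto
  have inv: "chart_inv c (snd c q) = q" if "q \<in> fst c" for q
    using chart_inj[OF ch] that by simp
  have "(transition c c has_derivative (\<lambda>x. x)) (at (snd c p))"
    by (rule has_derivative_transform_within_open[OF has_derivative_ident chart_overlap_open[OF ch ch]])
       (use c inv in \<open>auto simp: transition_def\<close>)
  from fun_cong[OF frechet_derivative_at[OF this], of y] show ?thesis by simp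
qed

lemma tvec_in_TM:
  assumes M: "smooth_manifold M A" and c: "c \<in> A" "x \<in> chart_image c"
  shows "tvec A c x y \<in> TM M A" "snd (tvec A c x y) c = y"
proof -
  obtain p where p: "p \<in> fst c" "x = snd c p" using c by auto
  have ch: "is_chart M c" using M c unfolding smooth_manifold_def by auto
  have inv: "chart_inv c x = p" using chart_inj[OF ch] p by simp
  show "snd (tvec A c x y) c = y"
    using transition_deriv_self[OF M c(1) p(1)] p c inv by (simp add: tvec_def)
  have "p \<in> topspace M" using M c(1) p(1) unfolding smooth_manifold_def by blast
  then show "tvec A c x y \<in> TM M A"
    using transition_deriv_compose[OF M c(1) _ _ p(1)] unfolding tvec_def TM_def inv p(2)[symmetric]
    by (simp add: p(2))
qed

lemma tvec_components:
  assumes M: "smooth_manifold M A" and c: "c \<in> A" and v: "v \<in> TM M A" "fst v \<in> fst c"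
  shows "v = tvec A c (snd c (fst v)) (snd v c)"
proof -
  obtain p w where pw: "v = (p, w)" by (cases v)
  have p: "p \<in> fst c" using v(2) pw by simp
  have zero: "\<forall>d. d \<notin> A \<or> p \<notin> fst d \<longrightarrow> w d = 0"
    and trans: "\<forall>c\<in>A. \<forall>d\<in>A. p \<in> fst c \<and> p \<in> fst d \<longrightarrow>
        w d = frechet_derivative (transition c d) (at (snd c p)) (w c)"
    using v(1) unfolding TM_def pw by blast+
  have "is_chart M c" using M c unfolding smooth_manifold_def by blast
  then have inv: "chart_inv c (snd c p) = p" using chart_inj p inv_into_f_f by metis
  have "w = (\<lambda>d. if d \<in> A \<and> p \<in> fst d
     then frechet_derivative (transition c d) (at (snd c p)) (w c) else 0)"
  proof
    fix d
    show "w d = (if d \<in> A \<and> p \<in> fst d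
     then frechet_derivative (transition c d) (at (snd c p)) (w c) else 0)"
    proof (cases "d \<in> A \<and> p \<in> fst d")
      case True
      then have "w d = frechet_derivative (transition c d) (at (snd c p)) (w c)"
        using trans c p by blast
      with True show ?thesis by (simp only: if_True simp_thms)
    next
      case False
      then have "w d = 0" using zero by blast
      with False show ?thesis by (simp only: if_False)
    qed
  qed
  then show ?thesis unfolding pw tvec_def fst_conv snd_conv inv by (simp only: prod.inject simp_thms)
qed

end

theory Submission
  imports Defs
begin

text \<open>Since \<open>\<eta> a\<^sub>i\<^sub>j = g\<^sub>i\<^sub>j\<close> and \<open>\<partial>g\<^sub>i\<^sub>j/\<partial>y\<^sup>k\<close> is totally symmetric, the left hand side of the condition equals
  \<open>(n - 1) g\<^sup>j\<^sup>k \<partial>g\<^sub>j\<^sub>k/\<partial>y\<^sup>i\<close>, so the condition says that the mean Cartan torsion vanishes, and the theorem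
  becomes Deicke's theorem on each tangent space. Let \<open>D = \<partial>g/\<partial>y\<^sup>k\<close>. If \<open>tr (g\<^sup>-\<^sup>1 \<partial>g) = 0\<close> then \<open>g\<^sup>-\<^sup>1\<close> has
  divergence-free columns, and the vector field \<open>X = g\<^sup>-\<^sup>1 grad g\<^sub>k\<^sub>k\<close> has divergence
  \<open>tr (g\<^sup>-\<^sup>1 D g\<^sup>-\<^sup>1 D) \<ge> 0\<close>. By homogeneity \<open>X\<close> is tangent to the level sets of \<open>F\<close>, so multiplying it by a
  cut-off \<open>\<phi>(F\<^sup>2)\<close> yields a compactly supported field with divergence \<open>\<phi>(F\<^sup>2) tr (g\<^sup>-\<^sup>1 D g\<^sup>-\<^sup>1 D)\<close>. Its
  integral vanishes, which forces \<open>D = 0\<close>.\<close>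

section \<open>Calculus of smooth functions\<close>

text \<open>At a point of an open set the derivative depends only on nearby values in the set, so
  agreement on \<open>S\<close> passes from \<open>f\<close> and \<open>g\<close> to their
  directional derivatives and the induction goes on.\<close>

lemma C_k_on_cong:
  assumes "open S" "\<And>x. x \<in> S \<Longrightarrow> f x = g x" "C_k_on k S f"
  shows "C_k_on k S g"
  using assms(2,3)
proof (induction k arbitrary: f g)
  case 0
  then show ?case by (simp cong: continuous_on_cong)
next
  case (Suc k)
  have d: "g differentiable (at x)" "frechet_derivative g (at x) = frechet_derivative f (at x)" if "x \<in> S" for x
  proof -
    have "(f has_derivative frechet_derivative f (at x)) (at x)"
      using Suc.prems that by (auto simp: frechet_derivative_works)
    then have "(g has_derivative frechet_derivative f (at x)) (at x)"
      by (rule has_derivative_transform_within_open[OF _ assms(1) that]) (rule Suc.prems)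
    then show "g differentiable (at x)" "frechet_derivative g (at x) = frechet_derivative f (at x)"
      by (auto simp: differentiable_def frechet_derivative_at[symmetric])
  qed
  have "C_k_on k S (\<lambda>x. frechet_derivative g (at x) v)" for v
    by (rule Suc.IH[of "\<lambda>x. frechet_derivative f (at x) v"]) (use d Suc.prems in auto)
  with d show ?case by auto
qed

text \<open>\<open>C_k_on\<close> speaks of \<open>frechet_derivative\<close>, while the
  differentiation rules supply some explicit \<open>f'\<close>. Uniqueness of the derivative
  identifies the two on \<open>S\<close>.\<close>

lemma C_k_on_Suc_I:
  assumes "open S" "\<And>x. x \<in> S \<Longrightarrow> (f has_derivative f' x) (at x)" "\<And>v. C_k_on k S (\<lambda>x. f' x v)"
  shows "C_k_on (Suc k) S f"
proof -
  have "C_k_on k S (\<lambda>x. frechet_derivative f (at x) v)" for v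
    by (rule C_k_on_cong[OF assms(1) _ assms(3)[of v]]) (use assms(2) frechet_derivative_at in metis)
  with assms(2) show ?thesis by (auto simp: differentiable_def)
qed

lemma C_k_on_SucD:
  assumes "C_k_on (Suc k) S f"
  shows "\<And>x. x \<in> S \<Longrightarrow> (f has_derivative frechet_derivative f (at x)) (at x)"
    and "\<And>v. C_k_on k S (\<lambda>x. frechet_derivative f (at x) v)"
  using assms by (auto simp: frechet_derivative_works)

lemma C_k_on_lower: "C_k_on (Suc k) S f \<Longrightarrow> C_k_on k S f"
proof (induction k arbitrary: f)
  case 0
  then show ?case
    by (auto intro!: continuous_at_imp_continuous_on differentiable_imp_continuous_within)
next
  case (Suc k)
  then show ?case by (metis C_k_on.simps(2))
qed

lemma C_k_on_const: "C_k_on k S (\<lambda>x. c)"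
  by (induction k arbitrary: c) auto

lemma C_k_on_add:
  assumes "open S" "C_k_on k S f" "C_k_on k S g"
  shows "C_k_on k S (\<lambda>x. f x + g x)"
  using assms(2,3)
proof (induction k arbitrary: f g)
  case 0
  then show ?case by (auto intro: continuous_intros)
next
  case (Suc k)
  show ?case
    by (rule C_k_on_Suc_I[OF assms(1) has_derivative_add[OF C_k_on_SucD(1) C_k_on_SucD(1)]])
       (use Suc in \<open>auto intro: C_k_on_SucD\<close>)
qed

text \<open>By the Leibniz rule each directional derivative is a sum of products. Its
  undifferentiated factors are one degree smoother than the induction hypothesis asks for, hence
  \<open>C_k_on_lower\<close>.\<close>

lemma C_k_on_mult:
  fixes f g :: "'a::real_normed_vector \<Rightarrow> real"
  assumes "open S" "C_k_on k S f" "C_k_on k S g"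
  shows "C_k_on k S (\<lambda>x. f x * g x)"
  using assms(2,3)
proof (induction k arbitrary: f g)
  case 0
  then show ?case by (auto intro: continuous_intros)
next
  case (Suc k)
  show ?case
    by (rule C_k_on_Suc_I[OF assms(1) has_derivative_mult[OF C_k_on_SucD(1) C_k_on_SucD(1)]])
       (use Suc.prems in \<open>auto intro!: C_k_on_add[OF assms(1)] Suc.IH simp: C_k_on_SucD C_k_on_lower
          simp del: C_k_on.simps\<close>)
qed

text \<open>The derivative \<open>- f' / f^2\<close> contains only \<open>f'\<close> and
  \<open>inverse (f x)\<close> itself, and the latter is already of class \<open>k\<close> by the
  induction hypothesis.\<close>

lemma C_k_on_inverse:
  fixes f :: "'a::real_normed_vector \<Rightarrow> real"
  assumes "open S" "C_k_on k S f" "\<And>x. x \<in> S \<Longrightarrow> f x \<noteq> 0"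
  shows "C_k_on k S (\<lambda>x. inverse (f x))"
  using assms(2)
proof (induction k)
  case 0
  then show ?case using assms(3) by (auto intro: continuous_intros)
next
  case (Suc k)
  have f: "C_k_on k S (\<lambda>x. inverse (f x))"
    using Suc C_k_on_lower by blast
  have "C_k_on k S (\<lambda>x. (- 1) * (inverse (f x) * frechet_derivative f (at x) v * inverse (f x)))" for v
    by (intro C_k_on_mult C_k_on_const assms(1) f C_k_on_SucD[OF Suc.prems])
  then show ?case
    by (intro C_k_on_Suc_I[OF assms(1) Deriv.has_derivative_inverse[OF assms(3) C_k_on_SucD(1)[OF Suc.prems]]])
       auto
qed

lemma C_k_on_bounded_linear:
  assumes "open S" "bounded_linear L" "C_k_on k S f"
  shows "C_k_on k S (\<lambda>x. L (f x))"
  using assms(3)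
proof (induction k arbitrary: f)
  case 0
  then show ?case using bounded_linear.continuous_on[OF assms(2)] by auto
next
  case (Suc k)
  show ?case
    by (rule C_k_on_Suc_I[OF assms(1) bounded_linear.has_derivative[OF assms(2) C_k_on_SucD(1)]])
       (use Suc in \<open>auto intro: C_k_on_SucD\<close>)
qed

text \<open>The derivative in direction \<open>v\<close> is that of \<open>f\<close> in direction
  \<open>L v\<close>, taken along the same affine map, so the induction closes at once. Covers
  slices of product domains and restriction to smaller sets.\<close>

lemma C_k_on_affine_compose:
  assumes "open S" "bounded_linear L" "C_k_on k T f" "\<And>x. x \<in> S \<Longrightarrow> b + L x \<in> T"
  shows "C_k_on k S (\<lambda>x. f (b + L x))"
  using assms(3)
proof (induction k arbitrary: f)
  case 0
  have "continuous_on S (\<lambda>x. b + L x)"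
    by (intro continuous_intros linear_continuous_on assms(2))
  with 0 show ?case using assms(4) by (auto intro: continuous_on_compose2)
next
  case (Suc k)
  have "((\<lambda>x. f (b + L x)) has_derivative (\<lambda>v. frechet_derivative f (at (b + L x)) (L v))) (at x)"
    if "x \<in> S" for x
  proof -
    have "((\<lambda>x. b + L x) has_derivative L) (at x)"
      using bounded_linear_imp_has_derivative[OF assms(2)] by (auto intro!: derivative_eq_intros)
    from diff_chain_at[OF this C_k_on_SucD(1)[OF Suc.prems assms(4)[OF that]]]
    show ?thesis by (simp add: o_def)
  qed
  then show ?case
    by (rule C_k_on_Suc_I[OF assms(1)])
       (use Suc.IH[OF C_k_on_SucD(2)[OF Suc.prems]] in auto)
qed

section \<open>Closure properties of smooth functions\<close>

lemma smooth_on_cong: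
  "open S \<Longrightarrow> (\<And>x. x \<in> S \<Longrightarrow> f x = g x) \<Longrightarrow> smooth_on S f \<Longrightarrow> smooth_on S g"
  unfolding smooth_on_def using C_k_on_cong by blast

lemma smooth_on_const: "smooth_on S (\<lambda>x. c)"
  by (simp add: smooth_on_def C_k_on_const)

lemma smooth_on_add:
  "open S \<Longrightarrow> smooth_on S f \<Longrightarrow> smooth_on S g \<Longrightarrow> smooth_on S (\<lambda>x. f x + g x)"
  by (simp add: smooth_on_def C_k_on_add)

lemma smooth_on_mult:
  fixes f g :: "'a::real_normed_vector \<Rightarrow> real"
  shows "open S \<Longrightarrow> smooth_on S f \<Longrightarrow> smooth_on S g \<Longrightarrow> smooth_on S (\<lambda>x. f x * g x)"
  by (simp add: smooth_on_def C_k_on_mult)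

lemma smooth_on_inverse:
  fixes f :: "'a::real_normed_vector \<Rightarrow> real"
  shows "open S \<Longrightarrow> smooth_on S f \<Longrightarrow> (\<And>x. x \<in> S \<Longrightarrow> f x \<noteq> 0) \<Longrightarrow> smooth_on S (\<lambda>x. inverse (f x))"
  by (simp add: smooth_on_def C_k_on_inverse)

lemma smooth_on_bounded_linear:
  "open S \<Longrightarrow> bounded_linear L \<Longrightarrow> smooth_on S f \<Longrightarrow> smooth_on S (\<lambda>x. L (f x))"
  by (simp add: smooth_on_def C_k_on_bounded_linear)

lemma smooth_on_affine_compose:
  assumes "open S" "bounded_linear L" "smooth_on T f" "\<And>x. x \<in> S \<Longrightarrow> b + L x \<in> T"
  shows "smooth_on S (\<lambda>x. f (b + L x))"
  using assms unfolding smooth_on_def by (blast intro: C_k_on_affine_compose)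

lemma smooth_on_sum:
  assumes "open S" "\<And>i. i \<in> I \<Longrightarrow> smooth_on S (f i)"
  shows "smooth_on S (\<lambda>x. \<Sum>i\<in>I. f i x)"
  using assms(2)
  by (induction I rule: infinite_finite_induct) (auto intro: smooth_on_const smooth_on_add assms(1))

lemma smooth_on_prod:
  fixes f :: "'i \<Rightarrow> 'a::real_normed_vector \<Rightarrow> real"
  assumes "open S" "\<And>i. i \<in> I \<Longrightarrow> smooth_on S (f i)"
  shows "smooth_on S (\<lambda>x. \<Prod>i\<in>I. f i x)"
  using assms(2)
  by (induction I rule: infinite_finite_induct) (auto intro: smooth_on_const smooth_on_mult assms(1))

lemma smooth_on_has_derivative:
  "smooth_on S f \<Longrightarrow> x \<in> S \<Longrightarrow> (f has_derivative frechet_derivative f (at x)) (at x)"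
  unfolding smooth_on_def by (meson C_k_on_SucD(1))

lemma smooth_on_differentiable: "smooth_on S f \<Longrightarrow> x \<in> S \<Longrightarrow> f differentiable (at x)"
  using smooth_on_has_derivative by (auto simp: differentiable_def)

lemma smooth_on_continuous_on: "smooth_on S f \<Longrightarrow> continuous_on S f"
  unfolding smooth_on_def by (metis C_k_on.simps(1))

lemma smooth_on_partial: "smooth_on S f \<Longrightarrow> smooth_on S (partial i f)"
  unfolding smooth_on_def partial_def[abs_def] using C_k_on_SucD(2) by blast

section \<open>Partial derivatives and their symmetry\<close>

lemma partial_eqI: "(f has_derivative f') (at y) \<Longrightarrow> partial i f y = f' (axis i 1)"
  by (metis frechet_derivative_at partial_def)

lemma differentiable_has_derivative:
  "f differentiable (at y) \<Longrightarrow> (f has_derivative frechet_derivative f (at y)) (at y)"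
  by (simp add: frechet_derivative_works)

lemma partial_cong:
  assumes "open S" "y \<in> S" "\<And>x. x \<in> S \<Longrightarrow> f x = g x" "f differentiable (at y)"
  shows "partial i f y = partial i g y"
  using frechet_derivative_transform_within_open[OF assms(4,1,2,3)] by (simp add: partial_def)

lemma partial_const: "partial i (\<lambda>x. c) y = 0"
  by (simp add: partial_def)

lemma partial_mult:
  "f differentiable (at y) \<Longrightarrow> g differentiable (at y) \<Longrightarrow>
   partial i (\<lambda>x. f x * g x) y = partial i f y * g y + f y * partial i g y"
  by (subst partial_eqI[OF has_derivative_mult[OF differentiable_has_derivative differentiable_has_derivative]])
     (auto simp: partial_def)

lemma partial_cmult: "f differentiable (at y) \<Longrightarrow> partial i (\<lambda>x. c * f x) y = c * partial i f y"
  by (simp add: partial_mult partial_const)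

lemma partial_sum:
  "(\<And>j. j \<in> J \<Longrightarrow> f j differentiable (at y)) \<Longrightarrow>
   partial i (\<lambda>x. \<Sum>j\<in>J. f j x) y = (\<Sum>j\<in>J. partial i (f j) y)"
  by (subst partial_eqI[OF has_derivative_sum[OF differentiable_has_derivative]])
     (auto simp: partial_def)

lemma frechet_derivative_eq_sum_partial:
  fixes f :: "real^'n::finite \<Rightarrow> real"
  assumes "f differentiable (at y)"
  shows "frechet_derivative f (at y) v = (\<Sum>i\<in>UNIV. v $ i * partial i f y)"
proof -
  have lin: "linear (frechet_derivative f (at y))"
    using assms linear_frechet_derivative by blast
  have "frechet_derivative f (at y) v = frechet_derivative f (at y) (\<Sum>i\<in>UNIV. v $ i *\<^sub>R axis i 1)"
    by (simp add: basis_expansion flip: scalar_mult_eq_scaleR)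
  also have "\<dots> = (\<Sum>i\<in>UNIV. v $ i * partial i f y)"
    by (simp add: linear_sum[OF lin] linear_scale[OF lin] partial_def)
  finally show ?thesis .
qed

lemma partial_has_real_derivative:
  assumes "f differentiable (at (y + s *\<^sub>R axis i 1))"
  shows "((\<lambda>s. f (y + s *\<^sub>R axis i 1)) has_real_derivative partial i f (y + s *\<^sub>R axis i 1)) (at s)"
proof -
  have "((\<lambda>s. y + s *\<^sub>R axis i 1) has_derivative (\<lambda>s. s *\<^sub>R axis i 1)) (at s)"
    by (auto intro!: derivative_eq_intros)
  from diff_chain_at[OF this differentiable_has_derivative[OF assms]]
  have "((\<lambda>s. f (y + s *\<^sub>R axis i 1)) has_derivative
     (\<lambda>t. frechet_derivative f (at (y + s *\<^sub>R axis i 1)) (t *\<^sub>R axis i 1))) (at s)"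
    by (simp add: o_def)
  moreover have "frechet_derivative f (at (y + s *\<^sub>R axis i 1)) (t *\<^sub>R axis i 1)
      = partial i f (y + s *\<^sub>R axis i 1) * t" for t
    using linear_scale[OF linear_frechet_derivative[OF assms]] by (simp add: partial_def)
  ultimately show ?thesis by (simp add: has_field_derivative_def)
qed

text \<open>The mean value theorem, applied twice, writes the second difference of \<open>f\<close> over a small square
  as \<open>t\<^sup>2\<close> times a value of the mixed partial nearby.\<close>

lemma second_difference_mean_value:
  fixes f :: "real^'n::finite \<Rightarrow> real"
  assumes f: "smooth_on (ball y r) f" and t: "0 < t" "2 * t < r"
  obtains z where "z \<in> ball y r"
    "f (y + t *\<^sub>R axis i 1 + t *\<^sub>R axis j 1) - f (y + t *\<^sub>R axis i 1) - f (y + t *\<^sub>R axis j 1) + f y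
     = t\<^sup>2 * partial j (partial i f) z"
proof -
  have mem: "y + p *\<^sub>R axis i 1 + q *\<^sub>R axis j 1 \<in> ball y r" if "0 \<le> p" "p \<le> t" "0 \<le> q" "q \<le> t" for p q
  proof -
    have "norm (p *\<^sub>R axis i 1 + q *\<^sub>R axis j (1::real) :: real^'n) \<le> p + q"
      using that by (intro norm_triangle_le) auto
    then have "dist (y + (p *\<^sub>R axis i 1 + q *\<^sub>R axis j (1::real))) y < r"
      using that t by (simp only: dist_norm add_diff_cancel_left')
    then show ?thesis by (simp add: add.assoc dist_commute)
  qed
  \<comment> \<open>The difference of \<open>f\<close> across direction \<open>j\<close>, as a
    function of the position in direction \<open>i\<close>. Its increment over \<open>[0, t]\<close>
    is the second difference.\<close>
  let ?\<phi> = "\<lambda>p. f (y + t *\<^sub>R axis j 1 + p *\<^sub>R axis i 1) - f (y + p *\<^sub>R axis i 1)"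
  have "\<exists>p. 0 < p \<and> p < t \<and> ?\<phi> t - ?\<phi> 0 = (t - 0) *
      (partial i f (y + t *\<^sub>R axis j 1 + p *\<^sub>R axis i 1) - partial i f (y + p *\<^sub>R axis i 1))"
  proof (rule MVT2[OF t(1)])
    fix p assume p: "0 \<le> p" "p \<le> t"
    show "(?\<phi> has_real_derivative
       partial i f (y + t *\<^sub>R axis j 1 + p *\<^sub>R axis i 1) - partial i f (y + p *\<^sub>R axis i 1)) (at p)"
      using mem[OF p, of t] mem[OF p, of 0] t
      by (intro DERIV_diff partial_has_real_derivative smooth_on_differentiable[OF f])
         (auto simp: algebra_simps)
  qed
  then obtain p where p: "0 < p" "p < t" and 1: "?\<phi> t - ?\<phi> 0 = t *
      (partial i f (y + t *\<^sub>R axis j 1 + p *\<^sub>R axis i 1) - partial i f (y + p *\<^sub>R axis i 1))"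
    by auto
  let ?\<psi> = "\<lambda>q. partial i f (y + p *\<^sub>R axis i 1 + q *\<^sub>R axis j 1)"
  have "\<exists>q. 0 < q \<and> q < t \<and> ?\<psi> t - ?\<psi> 0 = (t - 0) * partial j (partial i f) (y + p *\<^sub>R axis i 1 + q *\<^sub>R axis j 1)"
  proof (rule MVT2[OF t(1)])
    fix q assume q: "0 \<le> q" "q \<le> t"
    show "(?\<psi> has_real_derivative partial j (partial i f) (y + p *\<^sub>R axis i 1 + q *\<^sub>R axis j 1)) (at q)"
      using mem[OF _ _ q, of p] p
      by (intro partial_has_real_derivative smooth_on_differentiable[OF smooth_on_partial[OF f]]) auto
  qed
  then obtain q where q: "0 < q" "q < t"
    and 2: "?\<psi> t - ?\<psi> 0 = t * partial j (partial i f) (y + p *\<^sub>R axis i 1 + q *\<^sub>R axis j 1)"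
    by auto
  have "?\<phi> t - ?\<phi> 0 = t\<^sup>2 * partial j (partial i f) (y + p *\<^sub>R axis i 1 + q *\<^sub>R axis j 1)"
    using 1 2 by (simp add: power2_eq_square algebra_simps)
  then show thesis
    using that[OF mem[of p q]] p q by (simp add: algebra_simps)
qed

text \<open>The second difference in \<open>second_difference_mean_value\<close> is symmetric in
  \<open>i\<close> and \<open>j\<close>, so the two mixed partials agree at some pair of points
  close to \<open>y\<close>. Continuity then leaves no gap between them at \<open>y\<close>.\<close>

lemma partial_commute:
  fixes f :: "real^'n::finite \<Rightarrow> real"
  assumes S: "open S" "y \<in> S" and f: "smooth_on S f"
  shows "partial i (partial j f) y = partial j (partial i f) y"
proof (rule ccontr)
  let ?P = "partial i (partial j f)" and ?Q = "partial j (partial i f)"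
  assume ne: "?P y \<noteq> ?Q y"
  \<comment> \<open>Half the gap: a number within \<open>e\<close> of \<open>?P y\<close> cannot
    also be within \<open>e\<close> of \<open>?Q y\<close>.\<close>
  define e where "e = \<bar>?P y - ?Q y\<bar> / 2"
  have e: "e > 0" using ne by (simp add: e_def)
  have "\<exists>d>0. \<forall>z\<in>S. dist z y < d \<longrightarrow> dist (h z) (h y) < e" if "smooth_on S h" for h :: "real^'n \<Rightarrow> real"
    using smooth_on_continuous_on[OF that] S(2) e unfolding continuous_on_iff by blast
  from this[OF smooth_on_partial[OF smooth_on_partial[OF f]], of i j]
    this[OF smooth_on_partial[OF smooth_on_partial[OF f]], of j i]
  obtain d1 d2 where d: "d1 > 0" "d2 > 0"
    "\<forall>z\<in>S. dist z y < d1 \<longrightarrow> dist (?P z) (?P y) < e" "\<forall>z\<in>S. dist z y < d2 \<longrightarrow> dist (?Q z) (?Q y) < e"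
    by blast
  obtain d3 where d3: "d3 > 0" "ball y d3 \<subseteq> S"
    using S open_contains_ball by blast
  define r where "r = min d3 (min d1 d2)"
  have r: "r > 0" using d d3 by (simp add: r_def)
  have sub: "ball y r \<subseteq> S" using d3 by (auto simp: r_def)
  have fr: "smooth_on (ball y r) f"
    using smooth_on_affine_compose[OF open_ball bounded_linear_ident f, of y r 0] sub
    unfolding add_0_left by blast
  obtain z1 where z1: "z1 \<in> ball y r"
    "f (y + (r/4) *\<^sub>R axis i 1 + (r/4) *\<^sub>R axis j 1) - f (y + (r/4) *\<^sub>R axis i 1) - f (y + (r/4) *\<^sub>R axis j 1) + f y
     = (r/4)\<^sup>2 * ?Q z1"
    using second_difference_mean_value[OF fr, of "r/4" i j] r by auto
  obtain z2 where z2: "z2 \<in> ball y r"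
    "f (y + (r/4) *\<^sub>R axis j 1 + (r/4) *\<^sub>R axis i 1) - f (y + (r/4) *\<^sub>R axis j 1) - f (y + (r/4) *\<^sub>R axis i 1) + f y
     = (r/4)\<^sup>2 * ?P z2"
    using second_difference_mean_value[OF fr, of "r/4" j i] r by auto
  have "(r/4)\<^sup>2 * ?Q z1 = (r/4)\<^sup>2 * ?P z2"
    using z1(2) z2(2) by (simp add: algebra_simps)
  then have "?Q z1 = ?P z2" using r by simp
  moreover have "dist (?Q z1) (?Q y) < e" "dist (?P z2) (?P y) < e"
    using z1(1) z2(1) d sub by (auto simp: r_def dist_commute subset_iff)
  ultimately have "dist (?P y) (?Q y) < 2 * e"
    by (auto simp: dist_real_def)
  then show False by (simp add: e_def dist_real_def)
qed

section \<open>Homogeneous functions\<close>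

text \<open>Both sides of the homogeneity relation are differentiated, the left one by the chain
  rule. Keeping the factor \<open>t\<close> on the left instead of writing
  \<open>t ^ (k - 1)\<close> lets degree \<open>0\<close> be an instance.\<close>

lemma homogeneous_partial:
  fixes f :: "real^'n::finite \<Rightarrow> real"
  assumes f: "\<And>y. y \<noteq> 0 \<Longrightarrow> f differentiable (at y)"
    and h: "\<And>t y. t > 0 \<Longrightarrow> y \<noteq> 0 \<Longrightarrow> f (t *\<^sub>R y) = t ^ k * f y"
    and t: "t > 0" "y \<noteq> 0"
  shows "t * partial i f (t *\<^sub>R y) = t ^ k * partial i f y"
proof -
  have ty: "t *\<^sub>R y \<noteq> 0" using t by simp
  have "((*\<^sub>R) t has_derivative (*\<^sub>R) t) (at y)"
    by (auto intro!: derivative_eq_intros)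
  from diff_chain_at[OF this differentiable_has_derivative[OF f[OF ty]]]
  have 1: "((\<lambda>y. f (t *\<^sub>R y)) has_derivative (\<lambda>v. frechet_derivative f (at (t *\<^sub>R y)) (t *\<^sub>R v))) (at y)"
    by (simp add: o_def)
  have "partial i (\<lambda>y. f (t *\<^sub>R y)) y = t * partial i f (t *\<^sub>R y)"
    using linear_scale[OF linear_frechet_derivative[OF f[OF ty]]]
    by (simp only: partial_eqI[OF 1]) (simp add: partial_def)
  moreover have "partial i (\<lambda>y. f (t *\<^sub>R y)) y = partial i (\<lambda>y. t ^ k * f y) y"
    by (rule partial_cong[of "- {0}"]) (use t h 1 in \<open>auto simp: differentiable_def\<close>)
  ultimately show ?thesis
    using partial_cmult[OF f[OF t(2)], of i "t ^ k"] by simp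
qed

text \<open>The derivative of \<open>f (t *\<^sub>R y)\<close> in \<open>t\<close> at
  \<open>t = 1\<close> is computed twice, by the chain rule and from homogeneity, which holds on the
  open set of positive \<open>t\<close>.\<close>

lemma Euler_homogeneous:
  fixes f :: "real^'n::finite \<Rightarrow> real"
  assumes f: "f differentiable (at y)" and y: "y \<noteq> 0"
    and h: "\<And>t. t > 0 \<Longrightarrow> f (t *\<^sub>R y) = t ^ k * f y"
  shows "(\<Sum>i\<in>UNIV. y $ i * partial i f y) = real k * f y"
proof -
  have "((\<lambda>t. t *\<^sub>R y) has_derivative (\<lambda>t. t *\<^sub>R y)) (at 1)"
    by (auto intro!: derivative_eq_intros)
  from diff_chain_at[OF this, of f] differentiable_has_derivative[OF f]
  have "((\<lambda>t. f (t *\<^sub>R y)) has_derivative (\<lambda>t. frechet_derivative f (at y) (t *\<^sub>R y))) (at 1)"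
    by (simp add: o_def)
  moreover have "frechet_derivative f (at y) (t *\<^sub>R y) = frechet_derivative f (at y) y * t" for t
    using linear_scale[OF linear_frechet_derivative[OF f]] by simp
  ultimately have 1: "((\<lambda>t. f (t *\<^sub>R y)) has_real_derivative frechet_derivative f (at y) y) (at 1)"
    by (simp add: has_field_derivative_def)
  have 2: "((\<lambda>t. f (t *\<^sub>R y)) has_real_derivative real k * f y) (at 1)"
  proof (rule has_field_derivative_transform_within_open)
    show "((\<lambda>t. t ^ k * f y) has_real_derivative real k * f y) (at 1)"
      by (auto intro!: derivative_eq_intros)
    show "open {0::real<..}" by simp
  qed (auto simp: h)
  show ?thesis
    using DERIV_unique[OF 1 2] frechet_derivative_eq_sum_partial[OF f, of y] by simp
qed

section \<open>Positive definite matrices\<close>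

lemma pos_def_matrix_invertible:
  fixes g :: "real^'n^'n::finite"
  assumes "pos_def_matrix g"
  shows "matrix_inv g ** g = mat 1" "g ** matrix_inv g = mat 1"
proof -
  have "v = 0" if "g *v v = 0" for v
    using assms that unfolding pos_def_matrix_def by (metis inner_zero_right less_irrefl)
  then have "invertible g"
    by (metis invertible_left_inverse matrix_left_invertible_ker)
  then have "\<exists>B. g ** B = mat 1 \<and> B ** g = mat 1"
    by (simp add: invertible_def)
  from someI_ex[OF this] show "matrix_inv g ** g = mat 1" "g ** matrix_inv g = mat 1"
    unfolding matrix_inv_def by auto
qed

lemma pos_def_matrix_symmetric: "pos_def_matrix A \<Longrightarrow> A $ i $ j = A $ j $ i"
  unfolding pos_def_matrix_def transpose_def by (metis vec_lambda_beta)

lemma inner_symmetric_matrix: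
  fixes A :: "real^'n^'n::finite"
  shows "transpose A = A \<Longrightarrow> v \<bullet> (A *v w) = (A *v v) \<bullet> w"
  by (metis dot_lmul_matrix vector_transpose_matrix)

text \<open>With \<open>w = matrix_inv g *v v\<close> the form of the inverse at \<open>v\<close> is
  that of \<open>g\<close> at \<open>w\<close>.\<close>

lemma pos_def_matrix_inv:
  fixes g :: "real^'n^'n::finite"
  assumes g: "pos_def_matrix g"
  shows "pos_def_matrix (matrix_inv g)"
proof -
  let ?P = "matrix_inv g"
  note inv = pos_def_matrix_invertible[OF g]
  have sg: "transpose g = g" using g by (simp add: pos_def_matrix_def)
  have "transpose ?P ** g = mat 1"
    using inv(2) sg by (metis matrix_transpose_mul transpose_mat)
  then have sP: "transpose ?P = ?P"
    using inv(2) by (metis matrix_mul_assoc matrix_mul_lid matrix_mul_rid)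
  have "0 < v \<bullet> (?P *v v)" if "v \<noteq> 0" for v
  proof -
    have gP: "g *v (?P *v v) = v" by (simp add: matrix_vector_mul_assoc inv)
    then have "?P *v v \<noteq> 0" using that by auto
    then have "0 < (?P *v v) \<bullet> (g *v (?P *v v))" using g by (simp add: pos_def_matrix_def)
    then show ?thesis by (simp add: gP inner_commute)
  qed
  with sP show ?thesis by (simp add: pos_def_matrix_def)
qed

section \<open>Semidefinite matrices and traces of products\<close>

text \<open>Elimination clears a row, so it leaves the class of definite matrices but stays within
  this one.\<close>

definition psd_matrix :: "real^'n^'n \<Rightarrow> bool" where
  "psd_matrix A \<longleftrightarrow> transpose A = A \<and> (\<forall>v. 0 \<le> v \<bullet> (A *v v))"

lemma pos_def_matrix_imp_psd: "pos_def_matrix A \<Longrightarrow> psd_matrix A"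
  unfolding pos_def_matrix_def psd_matrix_def
  by (metis inner_zero_left less_eq_real_def)

lemma quadratic_form_sum:
  fixes A :: "real^'n^'n::finite"
  shows "v \<bullet> (A *v w) = (\<Sum>i\<in>UNIV. \<Sum>j\<in>UNIV. v $ i * A $ i $ j * w $ j)"
  by (simp add: inner_vec_def matrix_vector_mult_def sum_distrib_left mult.assoc)

lemma quadratic_form_axis:
  fixes A :: "real^'n^'n::finite"
  shows "axis i 1 \<bullet> (A *v v) = A $ i \<bullet> v" "axis i 1 \<bullet> (A *v axis j 1) = A $ i $ j"
  by (simp_all add: inner_axis' matrix_vector_mul_component inner_axis)

text \<open>\<open>A\<close> minus the rank one matrix that, for symmetric \<open>A\<close> with a
  nonzero pivot, clears row and column \<open>k\<close>. The full size is kept, so that elimination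
  can run over sets of indices inside one type.\<close>

definition schur_complement :: "'n \<Rightarrow> real^'n^'n \<Rightarrow> real^'n^'n" where
  "schur_complement k A = (\<chi> i j. A $ i $ j - A $ k $ i * A $ k $ j / A $ k $ k)"

lemma schur_complement_form:
  fixes A :: "real^'n^'n::finite"
  shows "v \<bullet> (schur_complement k A *v v) = v \<bullet> (A *v v) - (A $ k \<bullet> v)\<^sup>2 / A $ k $ k"
proof -
  have "(A $ k \<bullet> v)\<^sup>2 / A $ k $ k = (\<Sum>i\<in>UNIV. \<Sum>j\<in>UNIV. v $ i * (A $ k $ i * A $ k $ j / A $ k $ k) * v $ j)"
    by (simp add: power2_eq_square inner_vec_def sum_product sum_divide_distrib mult_ac)
  then show ?thesis
    by (simp add: quadratic_form_sum schur_complement_def algebra_simps sum_subtractf)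
qed

text \<open>Completing the square: the form of the complement at \<open>v\<close> is that of
  \<open>A\<close> at \<open>v\<close> moved along \<open>axis k 1\<close>.\<close>

lemma psd_schur_complement:
  fixes A :: "real^'n^'n::finite"
  assumes A: "psd_matrix A" and k: "A $ k $ k > 0"
  shows "psd_matrix (schur_complement k A)"
proof -
  have sA: "transpose A = A" using A by (simp add: psd_matrix_def)
  then have "transpose (schur_complement k A) = schur_complement k A"
    by (simp add: vec_eq_iff transpose_def schur_complement_def mult.commute)
  moreover have "0 \<le> v \<bullet> (schur_complement k A *v v)" for v
  proof -
    \<comment> \<open>The value of \<open>s\<close> at which the form of \<open>A\<close> is least
      on the line \<open>v - s *\<^sub>R axis k 1\<close>.\<close>
    define s where "s = A $ k \<bullet> v / A $ k $ k"
    let ?w = "v - s *\<^sub>R axis k 1"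
    have s: "v \<bullet> (A *v axis k 1) = A $ k \<bullet> v"
      using inner_symmetric_matrix[OF sA, of v "axis k 1"] by (simp add: inner_axis matrix_vector_mul_component)
    have "0 \<le> ?w \<bullet> (A *v ?w)" using A by (simp add: psd_matrix_def)
    also have "?w \<bullet> (A *v ?w) = v \<bullet> (A *v v) - 2 * s * (A $ k \<bullet> v) + s\<^sup>2 * A $ k $ k"
      by (simp add: matrix_vector_mult_diff_distrib matrix_vector_mult_scaleR inner_diff_left inner_diff_right
          quadratic_form_axis inner_axis s power2_eq_square algebra_simps)
    also have "\<dots> = v \<bullet> (schur_complement k A *v v)"
      using k by (simp add: schur_complement_form s_def field_simps power2_eq_square)
    finally show ?thesis .
  qed
  ultimately show ?thesis by (simp add: psd_matrix_def)
qed

text \<open>Contracting the rank one term with \<open>R\<close> gives the form of \<open>R\<close>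
  at row \<open>k\<close> of \<open>A\<close>, over the pivot. For semidefinite \<open>R\<close> and
  a positive pivot this shows the sign of what each elimination step splits off.\<close>

lemma trace_schur_complement:
  fixes A R :: "real^'n^'n::finite"
  shows "(\<Sum>i\<in>UNIV. \<Sum>j\<in>UNIV. A $ i $ j * R $ i $ j) =
    (\<Sum>i\<in>UNIV. \<Sum>j\<in>UNIV. schur_complement k A $ i $ j * R $ i $ j) + A $ k \<bullet> (R *v A $ k) / A $ k $ k"
proof -
  have "A $ k \<bullet> (R *v A $ k) / A $ k $ k = (\<Sum>i\<in>UNIV. \<Sum>j\<in>UNIV. A $ k $ i * A $ k $ j / A $ k $ k * R $ i $ j)"
    by (simp add: quadratic_form_sum sum_divide_distrib mult_ac)
  then show ?thesis
    by (simp add: schur_complement_def left_diff_distrib sum_subtractf)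
qed

text \<open>Along \<open>axis j 1 + s *\<^sub>R axis k 1\<close> the form is affine in
  \<open>s\<close> with slope \<open>2 * A $ k $ j\<close>, and an affine function bounded below on
  the line has slope zero.\<close>

lemma psd_zero_diagonal:
  fixes A :: "real^'n^'n::finite"
  assumes A: "psd_matrix A" and k: "A $ k $ k = 0"
  shows "A $ k $ j = 0"
proof (rule ccontr)
  assume ne: "A $ k $ j \<noteq> 0"
  \<comment> \<open>Solves \<open>A $ j $ j + 2 * s * A $ k $ j = - 1\<close>.\<close>
  define s where "s = - (A $ j $ j + 1) / (2 * A $ k $ j)"
  let ?w = "axis j 1 + s *\<^sub>R axis k 1"
  have sA: "A $ j $ k = A $ k $ j"
    using A unfolding psd_matrix_def transpose_def by (metis vec_lambda_beta)
  have "0 \<le> ?w \<bullet> (A *v ?w)" using A by (simp add: psd_matrix_def)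
  also have "?w \<bullet> (A *v ?w) = A $ j $ j + 2 * s * A $ k $ j"
    by (simp add: matrix_vector_right_distrib matrix_vector_mult_scaleR inner_add_left inner_add_right
          quadratic_form_axis inner_axis sA k algebra_simps)
  also have "\<dots> = -1" using ne by (simp add: s_def field_simps)
  finally show False by simp
qed

text \<open>Symmetric Gaussian elimination: each step splits a rank one term off \<open>A\<close> and clears one more
  row.\<close>

lemma trace_psd_nonneg:
  fixes A R :: "real^'n^'n::finite"
  assumes A: "psd_matrix A" and R: "psd_matrix R"
  shows "0 \<le> (\<Sum>i\<in>UNIV. \<Sum>j\<in>UNIV. A $ i $ j * R $ i $ j)"
proof -
  \<comment> \<open>\<open>I\<close> contains the indices of the rows not yet cleared. The matrix
    changes at each step, so the claim is made for all \<open>A\<close>.\<close>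
  have "psd_matrix A \<Longrightarrow> (\<And>i j. i \<notin> I \<Longrightarrow> A $ i $ j = 0) \<Longrightarrow>
     0 \<le> (\<Sum>i\<in>UNIV. \<Sum>j\<in>UNIV. A $ i $ j * R $ i $ j)" if "finite I" for I
    using that
  proof (induction I arbitrary: A)
    case empty
    then show ?case by simp
  next
    case (insert k I)
    have "0 \<le> axis k 1 \<bullet> (A *v axis k 1)"
      using insert.prems(1) unfolding psd_matrix_def by blast
    then have "0 \<le> A $ k $ k" by (simp add: quadratic_form_axis inner_axis)
    then consider "A $ k $ k = 0" | "A $ k $ k > 0" by linarith
    then show ?case
    proof cases
      \<comment> \<open>With a vanishing pivot, semidefiniteness has already cleared row
        \<open>k\<close>, and the induction hypothesis applies to \<open>A\<close> itself.\<close>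
      case 1
      show ?thesis
        by (rule insert.IH[OF insert.prems(1)])
           (metis insert.prems(2) insert_iff psd_zero_diagonal[OF insert.prems(1) 1])
    next
      case 2
      have sym: "A $ i $ k = A $ k $ i" for i
        using insert.prems(1) unfolding psd_matrix_def transpose_def by (metis vec_lambda_beta)
      have "0 \<le> (\<Sum>i\<in>UNIV. \<Sum>j\<in>UNIV. schur_complement k A $ i $ j * R $ i $ j)"
      proof (rule insert.IH[OF psd_schur_complement[OF insert.prems(1) 2]])
        fix i j assume "i \<notin> I"
        show "schur_complement k A $ i $ j = 0"
        proof (cases "i = k")
          case True
          then show ?thesis using 2 by (simp add: schur_complement_def)
        next
          case False
          then have "A $ i $ j = 0" "A $ k $ i = 0"
            using insert.prems(2)[of i] \<open>i \<notin> I\<close> sym[of i] by auto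
          then show ?thesis by (simp add: schur_complement_def)
        qed
      qed
      moreover have "0 \<le> A $ k \<bullet> (R *v A $ k) / A $ k $ k"
        using R 2 by (simp add: psd_matrix_def)
      ultimately show ?thesis
        by (subst trace_schur_complement[of _ _ k]) linarith
    qed
  qed
  from this[of UNIV] A show ?thesis by simp
qed

lemma psd_congruence:
  fixes P D :: "real^'n^'n::finite"
  assumes "psd_matrix P" "transpose D = D"
  shows "psd_matrix (D ** P ** D)" "v \<bullet> ((D ** P ** D) *v v) = (D *v v) \<bullet> (P *v (D *v v))"
proof -
  show *: "v \<bullet> ((D ** P ** D) *v v) = (D *v v) \<bullet> (P *v (D *v v))" for v
    using inner_symmetric_matrix[OF assms(2), of v] by (simp flip: matrix_vector_mul_assoc)
  then show "psd_matrix (D ** P ** D)"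
    using assms by (simp add: psd_matrix_def matrix_transpose_mul matrix_mul_assoc)
qed

text \<open>Equality case of \<open>trace_psd_nonneg\<close>: splitting row \<open>k\<close> off
  \<open>P\<close> writes the trace as two nonnegative terms, so the form of \<open>P\<close>
  vanishes at \<open>D *v P $ k\<close>. Definiteness gives \<open>D ** P = 0\<close>, and
  \<open>P\<close> is invertible.\<close>

lemma trace_congruence_zero:
  fixes P D :: "real^'n^'n::finite"
  assumes P: "pos_def_matrix P" and D: "transpose D = D"
    and z: "(\<Sum>i\<in>UNIV. \<Sum>j\<in>UNIV. P $ i $ j * (D ** P ** D) $ i $ j) = 0"
  shows "D = 0"
proof -
  note psd = pos_def_matrix_imp_psd[OF P]
  note R = psd_congruence[OF psd D]
  have "D *v (P *v axis k 1) = 0" for k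
  proof -
    have "0 < axis k 1 \<bullet> (P *v axis k 1)"
      using P by (simp add: pos_def_matrix_def axis_eq_0_iff)
    then have k: "P $ k $ k > 0" by (simp add: quadratic_form_axis inner_axis)
    have "P $ k \<bullet> ((D ** P ** D) *v P $ k) / P $ k $ k \<le> 0"
      using trace_schur_complement[of P "D ** P ** D" k]
        trace_psd_nonneg[OF psd_schur_complement[OF psd k] R(1)] z by linarith
    then have "(D *v P $ k) \<bullet> (P *v (D *v P $ k)) \<le> 0"
      using k by (simp add: R(2) divide_le_0_iff)
    then have "D *v P $ k = 0"
      using P by (metis not_less pos_def_matrix_def)
    moreover have "P *v axis k 1 = P $ k"
      using pos_def_matrix_symmetric[OF P] by (simp add: vec_eq_iff matrix_vector_mul_component inner_axis)
    ultimately show ?thesis by simp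
  qed
  then have "(D ** P) *v axis k 1 = 0" for k
    by (simp flip: matrix_vector_mul_assoc)
  then have "(D ** P) $ i $ k = 0" for i k
    using quadratic_form_axis(2)[of i "D ** P" k] by simp
  then have DP: "D ** P = 0" by (simp add: vec_eq_iff)
  have "D = D ** P ** matrix_inv P"
    using pos_def_matrix_invertible[OF P] by (metis matrix_mul_assoc matrix_mul_rid)
  then show ?thesis by (simp add: DP)
qed

section \<open>Compactly supported vector fields\<close>

lemma compact_support_integrable:
  fixes f :: "'a::euclidean_space \<Rightarrow> real"
  assumes "continuous_on UNIV f" "\<And>x. norm x > R \<Longrightarrow> f x = 0"
  shows "integrable lborel f"
proof -
  have "integrable lborel (\<lambda>x. indicator (cball 0 R) x *\<^sub>R f x)"
    by (rule borel_integrable_compact) (use assms(1) continuous_on_subset in auto)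
  moreover have "(\<lambda>x. indicator (cball 0 R) x *\<^sub>R f x) = f"
    using assms(2) by (auto simp: fun_eq_iff indicator_def not_le)
  ultimately show ?thesis by simp
qed

lemma lborel_integral_translate:
  fixes f :: "'a::euclidean_space \<Rightarrow> real"
  assumes "integrable lborel f"
  shows "integrable lborel (\<lambda>x. f (x + c))" "(\<integral>x. f (x + c) \<partial>lborel) = (\<integral>x. f x \<partial>lborel)"
proof -
  have eq: "(\<lambda>x. f (x + c)) = (\<lambda>x. f (c + x))" by (simp add: add.commute)
  have f: "f \<in> borel_measurable borel" using borel_measurable_integrable[OF assms] by simp
  have "integrable (distr lborel borel ((+) c)) f" by (simp add: lborel_distr_plus assms)
  then show "integrable lborel (\<lambda>x. f (x + c))"
    unfolding eq by (subst (asm) integrable_distr_eq) (use f in auto)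
  have "(\<integral>x. f x \<partial>distr lborel borel ((+) c)) = (\<integral>x. f (c + x) \<partial>lborel)"
    by (rule integral_distr) (use f in auto)
  then show "(\<integral>x. f (x + c) \<partial>lborel) = (\<integral>x. f x \<partial>lborel)"
    unfolding eq lborel_distr_plus by simp
qed

lemma partial_outside_support:
  fixes w :: "real^'n::finite \<Rightarrow> real"
  assumes w: "\<And>y. w differentiable (at y)" "\<And>y. norm y > R \<Longrightarrow> w y = 0" and y: "norm y > R"
  shows "partial i w y = 0"
proof -
  have "partial i w y = partial i (\<lambda>_. 0) y"
    by (rule partial_cong[of "- cball 0 R"]) (use assms in auto)
  then show ?thesis by (simp add: partial_const)
qed

text \<open>By translation invariance every difference quotient of \<open>w\<close> has integral
  zero, and dominated convergence carries this over to the limit.\<close>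

lemma integral_partial_compact_support:
  fixes w :: "real^'n::finite \<Rightarrow> real"
  assumes w: "\<And>y. w differentiable (at y)" "continuous_on UNIV (partial i w)"
    and supp: "\<And>y. norm y > R \<Longrightarrow> w y = 0"
  shows "integrable lborel (partial i w)" "(\<integral>y. partial i w y \<partial>lborel) = 0"
proof -
  let ?e = "axis i 1 :: real^'n"
  note supp' = partial_outside_support[of w R, OF w(1) supp]
  show int': "integrable lborel (partial i w)"
    using compact_support_integrable[OF w(2) supp'] .
  have cw: "continuous_on UNIV w"
    using w(1) by (auto intro!: continuous_at_imp_continuous_on differentiable_imp_continuous_within)
  have int: "integrable lborel w" using compact_support_integrable[OF cw supp] .
  define h :: "nat \<Rightarrow> real" where "h n = 1 / real (Suc n)" for n
  have h: "h n > 0" "h n \<le> 1" for n by (auto simp: h_def)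
  have h0: "h \<longlonglongrightarrow> 0" unfolding h_def using LIMSEQ_inverse_real_of_nat by (simp add: inverse_eq_divide)
  define s where "s n x = (w (x + h n *\<^sub>R ?e) - w x) / h n" for n x
  have "bounded (partial i w ` cball 0 R)"
    by (intro compact_imp_bounded compact_continuous_image continuous_on_subset[OF w(2)]) auto
  then obtain B0 where B0: "\<forall>x\<in>cball 0 R. norm (partial i w x) \<le> B0"
    unfolding bounded_iff by auto
  \<comment> \<open>The maximum with \<open>0\<close> makes the bound valid outside
    \<open>cball 0 R\<close> too, where the derivative vanishes.\<close>
  define B where "B = max B0 0"
  have B: "norm (partial i w x) \<le> B" for x
    using B0 supp'[where y = x] by (cases "norm x > R") (auto simp: B_def le_max_iff_disj)
  have ints: "integrable lborel (s n)" "(\<integral>x. s n x \<partial>lborel) = 0" for n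
    using lborel_integral_translate[OF int, of "h n *\<^sub>R ?e"] int by (auto simp: s_def[abs_def])
  have lim: "(\<lambda>n. s n x) \<longlonglongrightarrow> partial i w x" for x
  proof -
    have "((\<lambda>t. w (x + t *\<^sub>R ?e)) has_real_derivative partial i w (x + 0 *\<^sub>R ?e)) (at 0)"
      by (rule partial_has_real_derivative) (rule w(1))
    then have "((\<lambda>t. (w (x + t *\<^sub>R ?e) - w x) / t) \<longlongrightarrow> partial i w x) (at 0)"
      by (simp add: DERIV_def)
    moreover have "filterlim h (at 0) sequentially"
      using h0 h(1) by (auto simp: filterlim_at intro!: always_eventually less_imp_neq[symmetric])
    ultimately show ?thesis
      unfolding s_def using filterlim_compose by blast
  qed
  \<comment> \<open>The shifts have length at most \<open>1\<close>, so beyond radius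
    \<open>R + 1\<close> both points of the difference quotient lie where \<open>w\<close> is
    zero.\<close>
  have bound: "norm (s n x) \<le> B * indicator (cball 0 (R + 1)) x" for n x
  proof (cases "norm x \<le> R + 1")
    case True
    have "\<exists>z. 0 < z \<and> z < h n \<and> w (x + h n *\<^sub>R ?e) - w (x + 0 *\<^sub>R ?e) = (h n - 0) * partial i w (x + z *\<^sub>R ?e)"
      by (rule MVT2[OF h(1)]) (rule partial_has_real_derivative[OF w(1)])
    then obtain z where "w (x + h n *\<^sub>R ?e) - w x = h n * partial i w (x + z *\<^sub>R ?e)" by auto
    then have "s n x = partial i w (x + z *\<^sub>R ?e)" using h(1)[of n] by (simp add: s_def)
    with B True show ?thesis by simp
  next
    case False
    have "norm x \<le> norm (x + h n *\<^sub>R ?e) + norm (h n *\<^sub>R ?e)"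
      by (metis add_diff_cancel_right' norm_triangle_ineq4)
    then have "norm x \<le> norm (x + h n *\<^sub>R ?e) + 1"
      using h[of n] by simp
    then have "w x = 0" "w (x + h n *\<^sub>R ?e) = 0" using False by (auto intro!: supp)
    then show ?thesis using False by (simp add: s_def)
  qed
  have "(\<lambda>n. \<integral>x. s n x \<partial>lborel) \<longlonglongrightarrow> (\<integral>x. partial i w x \<partial>lborel)"
  proof (rule integral_dominated_convergence)
    show "integrable lborel (\<lambda>x::real^'n. B * indicator (cball 0 (R + 1)) x)"
      using borel_integrable_compact[of "cball (0::real^'n) (R + 1)" "\<lambda>_. B"] by (simp add: mult.commute)
  qed (use ints int' lim bound in auto)
  then show "(\<integral>y. partial i w y \<partial>lborel) = 0"
    by (simp add: ints(2) LIMSEQ_const_iff)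
qed

text \<open>By nonnegativity the integral over a cube around \<open>y\<close> lies between
  \<open>0\<close> and the integral over the whole space, which reduces the claim to a continuous
  function on a box.\<close>

lemma continuous_nonneg_integral_zero:
  fixes f :: "'a::euclidean_space \<Rightarrow> real"
  assumes f: "continuous_on UNIV f" "\<And>x. 0 \<le> f x" "integrable lborel f" "(\<integral>x. f x \<partial>lborel) = 0"
  shows "f y = 0"
proof -
  have U: "(f has_integral 0) UNIV" using has_integral_integral_lborel[OF f(3)] f(4) by simp
  let ?b = "cbox (y - One) (y + One)"
  have "f integrable_on ?b"
    by (intro integrable_continuous continuous_on_subset[OF f(1)]) auto
  then obtain I where I: "(f has_integral I) ?b" by blast
  have "0 \<le> I" by (rule has_integral_nonneg[OF I]) (rule f(2))
  moreover have "I \<le> 0" by (rule has_integral_subset_le[OF _ I U]) (auto simp: f(2))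
  ultimately have "(f has_integral 0) ?b" using I by simp
  then show ?thesis
    by (rule has_integral_0_cbox_imp_0[OF continuous_on_subset[OF f(1)], rotated 2])
       (auto simp: f(2) box_ne_empty mem_box algebra_simps)
qed

text \<open>The divergence theorem for compact support has no boundary term, so the divergence has
  integral zero; having a sign as well, it vanishes pointwise.\<close>

lemma divergence_nonneg_imp_zero:
  fixes W :: "'n::finite \<Rightarrow> real^'n \<Rightarrow> real"
  assumes W: "\<And>i y. W i differentiable (at y)" "\<And>i. continuous_on UNIV (partial i (W i))"
    and supp: "\<And>i y. norm y > R \<Longrightarrow> W i y = 0"
    and nn: "\<And>y. 0 \<le> (\<Sum>i\<in>UNIV. partial i (W i) y)"
  shows "(\<Sum>i\<in>UNIV. partial i (W i) y) = 0"
proof (rule continuous_nonneg_integral_zero[of "\<lambda>y. \<Sum>i\<in>UNIV. partial i (W i) y"])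
  show "continuous_on UNIV (\<lambda>y. \<Sum>i\<in>UNIV. partial i (W i) y)"
    by (intro continuous_intros W(2))
qed (use integral_partial_compact_support[OF W supp] nn in auto)

section \<open>Extension across the origin and cut-off functions\<close>

text \<open>\<open>F^2\<close> is assumed smooth only off the zero vector. A field cut off near the
  origin is zero on a whole ball there, which removes the singularity.\<close>

lemma extend_by_zero:
  fixes w :: "real^'n::finite \<Rightarrow> real"
  assumes w: "\<And>y. y \<noteq> 0 \<Longrightarrow> w differentiable (at y)" "continuous_on (- {0}) (partial i w)"
    and r: "r > 0" "\<And>y. norm y < r \<Longrightarrow> w y = 0"
  shows "w differentiable (at y)" "continuous_on UNIV (partial i w)"
proof -
  have 0: "(w has_derivative (\<lambda>_. 0)) (at y)" if "y \<in> ball 0 r" for y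
    by (rule has_derivative_transform_within_open[of "\<lambda>_. 0" _ _ _ "ball 0 r"])
       (use that r(2) in auto)
  show "w differentiable (at y)"
    using w(1)[of y] 0[of 0] r(1) by (cases "y = 0") (auto simp: differentiable_def)
  have "continuous_on (ball 0 r) (partial i w)"
    using continuous_on_const[of "ball 0 r" 0]
    by (rule continuous_on_eq) (simp add: partial_eqI[OF 0])
  then have "continuous_on (- {0} \<union> ball 0 r) (partial i w)"
    by (intro continuous_on_open_Un w(2)) auto
  moreover have "- {0} \<union> ball 0 r = UNIV" using r(1) by auto
  ultimately show "continuous_on UNIV (partial i w)" by metis
qed

lemma partial_compose_real:
  fixes u :: "real^'n::finite \<Rightarrow> real"
  assumes "(\<phi> has_real_derivative d) (at (u y))" "u differentiable (at y)"
  shows "(\<lambda>y. \<phi> (u y)) differentiable (at y)" "partial i (\<lambda>y. \<phi> (u y)) y = d * partial i u y"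
proof -
  have *: "((\<lambda>y. \<phi> (u y)) has_derivative (\<lambda>v. d * frechet_derivative u (at y) v)) (at y)"
    using diff_chain_at[OF differentiable_has_derivative[OF assms(2)], of \<phi>] assms(1)
    by (simp add: o_def has_field_derivative_def)
  then show "(\<lambda>y. \<phi> (u y)) differentiable (at y)" by (auto simp: differentiable_def)
  show "partial i (\<lambda>y. \<phi> (u y)) y = d * partial i u y"
    by (simp only: partial_eqI[OF *]) (simp add: partial_def)
qed

text \<open>Squaring smooths the corner of \<open>max 0 s\<close>: at \<open>0\<close> the
  difference quotient is bounded by \<open>|h|\<close>.\<close>

lemma DERIV_max_zero_squared: "((\<lambda>s::real. (max 0 s)\<^sup>2) has_real_derivative 2 * max 0 s) (at s)"
proof -
  consider "s < 0" | "s = 0" | "s > 0" by linarith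
  then show ?thesis
  proof cases
    case 1
    have "((\<lambda>s::real. 0) has_real_derivative 2 * max 0 s) (at s)" using 1 by auto
    then show ?thesis
      by (rule has_field_derivative_transform_within_open[of _ _ _ "{..<0}"]) (use 1 in auto)
  next
    case 2
    have "((\<lambda>h::real. (max 0 h)\<^sup>2 / h) \<longlongrightarrow> 0) (at 0)"
    proof (rule Lim_null_comparison)
      show "\<forall>\<^sub>F h in at 0. norm ((max 0 h)\<^sup>2 / h) \<le> \<bar>h\<bar>"
        by (rule always_eventually) (auto simp: max_def power2_eq_square)
      show "((\<lambda>h::real. \<bar>h\<bar>) \<longlongrightarrow> 0) (at 0)"
        using tendsto_rabs[OF tendsto_ident_at, of 0 UNIV] by simp
    qed
    then show ?thesis by (simp add: 2 DERIV_def)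
  next
    case 3
    have "((\<lambda>s::real. s\<^sup>2) has_real_derivative 2 * max 0 s) (at s)"
      using 3 by (auto intro!: derivative_eq_intros)
    then show ?thesis
      by (rule has_field_derivative_transform_within_open[of _ _ _ "{0<..}"]) (use 3 in auto)
  qed
qed

text \<open>A cut-off positive exactly between \<open>1\<close> and \<open>2\<close>. It is only of
  class C^1, but the divergence argument differentiates it just once.\<close>

definition bump :: "real \<Rightarrow> real" where
  "bump s = (max 0 ((s - 1) * (2 - s)))\<^sup>2"

lemma DERIV_bump: "(bump has_real_derivative 2 * max 0 ((s - 1) * (2 - s)) * (3 - 2 * s)) (at s)"
proof -
  have "((\<lambda>s. (s - 1) * (2 - s)) has_real_derivative 3 - 2 * s) (at s)"
    by (auto intro!: derivative_eq_intros)
  from DERIV_chain2[OF DERIV_max_zero_squared this] show ?thesis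
    by (simp add: bump_def[abs_def])
qed

lemma bump_nonneg: "0 \<le> bump s"
  by (simp add: bump_def)

lemma bump_eq_0: "s \<le> 1 \<or> 2 \<le> s \<Longrightarrow> bump s = 0"
  by (auto simp: bump_def max_def zero_le_mult_iff)

section \<open>Deicke's theorem\<close>

lemma trace_mult_symmetric:
  fixes A B :: "real^'n^'n::finite"
  shows "transpose B = B \<Longrightarrow> trace (A ** B) = (\<Sum>i\<in>UNIV. \<Sum>j\<in>UNIV. A $ i $ j * B $ i $ j)"
  unfolding trace_def matrix_matrix_mult_def transpose_def
  by (auto simp: vec_eq_iff intro!: sum.cong)

lemma matrix_matrix_mult_add_left:
  fixes A B C :: "real^'n^'n::finite"
  shows "(A + B) ** C = A ** C + B ** C"
  by (simp add: vec_eq_iff matrix_matrix_mult_def distrib_right sum.distrib)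

section \<open>Smoothness of the inverse matrix\<close>

lemma smooth_on_det:
  fixes B :: "'a::real_normed_vector \<Rightarrow> real^'n^'n::finite"
  assumes "open S" "\<And>i j. smooth_on S (\<lambda>y. B y $ i $ j)"
  shows "smooth_on S (\<lambda>y. det (B y))"
  unfolding det_def
  by (intro smooth_on_sum smooth_on_mult smooth_on_prod smooth_on_const assms)

text \<open>Cramer's rule writes the entries as quotients of determinants, which are polynomials in
  matrix entries.\<close>

lemma smooth_on_matrix_inv:
  fixes B :: "'a::real_normed_vector \<Rightarrow> real^'n^'n::finite"
  assumes S: "open S" and B: "\<And>i j. smooth_on S (\<lambda>y. B y $ i $ j)"
    and pd: "\<And>y. y \<in> S \<Longrightarrow> pos_def_matrix (B y)"
  shows "smooth_on S (\<lambda>y. matrix_inv (B y) $ i $ j)"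
proof -
  \<comment> \<open>\<open>B y\<close> with column \<open>i\<close> replaced by the unit vector of
    index \<open>j\<close>.\<close>
  let ?C = "\<lambda>y. \<chi> r c. if c = i then axis j 1 $ r else B y $ r $ c"
  have d: "det (B y) \<noteq> 0" if "y \<in> S" for y
    using pos_def_matrix_invertible[OF pd[OF that]] by (metis invertible_det_nz invertible_right_inverse)
  have "smooth_on S (\<lambda>y. det (?C y) * inverse (det (B y)))"
  proof (intro smooth_on_mult smooth_on_inverse smooth_on_det S B d)
    show "smooth_on S (\<lambda>y. ?C y $ r $ c)" for r c
      by (cases "c = i") (simp_all add: B smooth_on_const)
  qed
  then show ?thesis
  proof (rule smooth_on_cong[OF S, rotated])
    fix y assume y: "y \<in> S"
    have "B y *v (matrix_inv (B y) *v axis j 1) = axis j 1"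
      using pos_def_matrix_invertible[OF pd[OF y]] by (simp add: matrix_vector_mul_assoc)
    then have "matrix_inv (B y) *v axis j 1 = (\<chi> k. det (\<chi> r c. if c = k then axis j 1 $ r else B y $ r $ c) / det (B y))"
      using cramer[OF d[OF y]] by blast
    then have "(matrix_inv (B y) *v axis j 1) $ i = det (?C y) / det (B y)" by simp
    then show "det (?C y) * inverse (det (B y)) = matrix_inv (B y) $ i $ j"
      by (simp add: matrix_vector_mul_component inner_axis divide_inverse)
  qed
qed

section \<open>The fundamental tensor on a single tangent space\<close>

text \<open>\<open>u\<close> stands for \<open>F^2\<close> on one tangent space in coordinates.
  \<open>g\<close> is a parameter tied to the Hessian of \<open>u\<close> by an assumption, so that
  \<open>fund_tensor\<close> can be put in its place directly.\<close>

locale minkowski_norm =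
  fixes u :: "real^'n::finite \<Rightarrow> real" and g :: "real^'n \<Rightarrow> real^'n^'n"
  assumes g_def: "g = (\<lambda>y. \<chi> i j. 1/2 * partial i (partial j u) y)"
    and smooth: "smooth_on (- {0}) u"
    and homogeneous: "\<And>t y. t > 0 \<Longrightarrow> y \<noteq> 0 \<Longrightarrow> u (t *\<^sub>R y) = t\<^sup>2 * u y"
    and pos_def: "\<And>y. y \<noteq> 0 \<Longrightarrow> pos_def_matrix (g y)"
begin

lemma g_nth: "g y $ i $ j = 1/2 * partial i (partial j u) y"
  by (simp add: g_def)

text \<open>Twice the Cartan torsion, sliced by the index of differentiation so that matrix algebra
  applies to each slice.\<close>

definition dg :: "'n \<Rightarrow> real^'n \<Rightarrow> real^'n^'n" where
  "dg k y = (\<chi> i j. partial k (\<lambda>z. g z $ i $ j) y)"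

lemma smooth_g: "smooth_on (- {0}) (\<lambda>y. g y $ i $ j)"
proof -
  have "smooth_on (- {0}) (\<lambda>y. 1/2 * partial i (partial j u) y)"
    by (intro smooth_on_mult smooth_on_const smooth_on_partial smooth) auto
  then show ?thesis by (simp add: g_nth)
qed

lemma smooth_dg: "smooth_on (- {0}) (\<lambda>y. dg k y $ i $ j)"
  using smooth_on_partial[OF smooth_g] by (simp add: dg_def)

lemma punctured_differentiable:
  fixes h :: "real^'n \<Rightarrow> real"
  shows "smooth_on (- {0}) h \<Longrightarrow> y \<noteq> 0 \<Longrightarrow> h differentiable (at y)"
  using smooth_on_differentiable by blast

lemma dg_swap_last: "y \<noteq> 0 \<Longrightarrow> dg k y $ i $ j = dg k y $ j $ i"
  unfolding dg_def vec_lambda_beta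
  by (rule partial_cong[of "- {0}"])
     (auto simp: pos_def_matrix_symmetric[OF pos_def] intro: punctured_differentiable smooth_g)

text \<open>\<open>dg\<close> is half the third derivative of \<open>u\<close>, and the order of
  differentiation does not matter.\<close>

lemma dg_swap_first:
  assumes "y \<noteq> 0"
  shows "dg k y $ i $ j = dg i y $ k $ j"
proof -
  have *: "dg k y $ i $ j = 1/2 * partial k (partial i (partial j u)) y" for k i
    unfolding dg_def vec_lambda_beta g_nth
    by (intro partial_cmult punctured_differentiable smooth_on_partial smooth assms)
  show ?thesis
    unfolding *
    using partial_commute[of "- {0}" y "partial j u" k i, OF open_Compl[OF closed_singleton]]
      smooth_on_partial[OF smooth] assms by simp
qed

lemma dg_symmetric: "y \<noteq> 0 \<Longrightarrow> transpose (dg k y) = dg k y"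
  using dg_swap_last by (simp add: vec_eq_iff transpose_def)

lemma partial_u_homogeneous: "t > 0 \<Longrightarrow> y \<noteq> 0 \<Longrightarrow> partial i u (t *\<^sub>R y) = t * partial i u y"
  using homogeneous_partial[of u 2 t y i] homogeneous smooth
  by (auto simp: punctured_differentiable power2_eq_square)

lemma g_homogeneous: "t > 0 \<Longrightarrow> y \<noteq> 0 \<Longrightarrow> g (t *\<^sub>R y) = g y"
  using homogeneous_partial[of "partial _ u" 1 t y] partial_u_homogeneous smooth
  by (auto simp: g_nth vec_eq_iff punctured_differentiable smooth_on_partial)

lemma dg_homogeneous: "t > 0 \<Longrightarrow> y \<noteq> 0 \<Longrightarrow> t *\<^sub>R dg k (t *\<^sub>R y) = dg k y"
  using homogeneous_partial[of "\<lambda>z. g z $ _ $ _" 0 t y k] g_homogeneous smooth_g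
  by (auto simp: dg_def vec_eq_iff punctured_differentiable)

text \<open>Euler's identity for the entries of \<open>g\<close>, which are constant along
  rays.\<close>

lemma dg_radial:
  assumes "y \<noteq> 0"
  shows "(\<Sum>k\<in>UNIV. y $ k * dg k y $ i $ j) = 0"
  using Euler_homogeneous[of "\<lambda>z. g z $ i $ j" y 0] g_homogeneous smooth_g assms
  by (simp add: dg_def punctured_differentiable)

text \<open>Euler's identity for the first partials of \<open>u\<close>, which have degree
  one.\<close>

lemma partial_u:
  assumes "y \<noteq> 0"
  shows "partial i u y = 2 * (g y *v y) $ i"
proof -
  have "(\<Sum>j\<in>UNIV. y $ j * partial j (partial i u) y) = partial i u y"
    using Euler_homogeneous[of "partial i u" y 1] partial_u_homogeneous assms smooth
    by (simp add: punctured_differentiable smooth_on_partial)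
  moreover have "partial j (partial i u) y = 2 * g y $ i $ j" for j
    using pos_def_matrix_symmetric[OF pos_def[OF assms], of i j] by (simp add: g_nth)
  ultimately show ?thesis
    by (simp add: matrix_vector_mult_def sum_distrib_left mult_ac)
qed

lemma u_eq: "y \<noteq> 0 \<Longrightarrow> u y = y \<bullet> (g y *v y)"
proof -
  assume y: "y \<noteq> 0"
  have "(\<Sum>i\<in>UNIV. y $ i * partial i u y) = 2 * u y"
    using Euler_homogeneous[of u y 2] homogeneous y smooth by (simp add: punctured_differentiable)
  then have "2 * u y = 2 * (y \<bullet> (g y *v y))"
    by (simp add: partial_u[OF y] inner_vec_def sum_distrib_left mult_ac)
  then show ?thesis by simp
qed

lemma u_pos: "y \<noteq> 0 \<Longrightarrow> u y > 0"
  using u_eq pos_def unfolding pos_def_matrix_def by metis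

text \<open>The extrema of \<open>u\<close> on the compact unit sphere, spread to all vectors by
  homogeneity. They later confine the cut-off field to an annulus.\<close>

lemma u_bounds:
  obtains m B where "0 < m" "0 < B" "\<And>y. y \<noteq> 0 \<Longrightarrow> m * (norm y)\<^sup>2 \<le> u y" "\<And>y. y \<noteq> 0 \<Longrightarrow> u y \<le> B * (norm y)\<^sup>2"
proof -
  let ?S = "sphere (0::real^'n) 1"
  have S: "compact ?S" "?S \<noteq> {}" by auto
  have c: "continuous_on ?S u"
    by (rule continuous_on_subset[OF smooth_on_continuous_on[OF smooth]]) auto
  obtain p where p: "p \<in> ?S" "\<And>y. y \<in> ?S \<Longrightarrow> u p \<le> u y"
    using continuous_attains_inf[OF S c] by blast
  obtain q where q: "q \<in> ?S" "\<And>y. y \<in> ?S \<Longrightarrow> u y \<le> u q"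
    using continuous_attains_sup[OF S c] by blast
  have pq: "0 < u p" "0 < u q" using p(1) q(1) by (auto intro!: u_pos)
  have *: "u y = u (y /\<^sub>R norm y) * (norm y)\<^sup>2" "y /\<^sub>R norm y \<in> ?S" if "y \<noteq> 0" for y
    using homogeneous[of "norm y" "y /\<^sub>R norm y"] that by auto
  show thesis
  proof (rule that[OF pq])
    fix y :: "real^'n" assume "y \<noteq> 0"
    from *[OF this] p(2) q(2) show "u p * (norm y)\<^sup>2 \<le> u y" "u y \<le> u q * (norm y)\<^sup>2"
      by (metis mult_right_mono zero_le_power2)+
  qed
qed

abbreviation ginv :: "real^'n \<Rightarrow> real^'n^'n" where
  "ginv y \<equiv> matrix_inv (g y)"

lemma smooth_ginv: "smooth_on (- {0}) (\<lambda>y. ginv y $ i $ j)"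
  by (rule smooth_on_matrix_inv) (auto intro: smooth_g pos_def)

text \<open>The identity \<open>ginv y ** g y = mat 1\<close> is differentiated and solved for the
  derivative of \<open>ginv\<close> by multiplying with \<open>ginv y\<close> on the right.\<close>

lemma partial_ginv:
  assumes y: "y \<noteq> 0"
  shows "partial k (\<lambda>z. ginv z $ i $ j) y = - (ginv y ** dg k y ** ginv y) $ i $ j"
proof -
  define dP where "dP = (\<chi> i j. partial k (\<lambda>z. ginv z $ i $ j) y)"
  have "(dP ** g y + ginv y ** dg k y) $ a $ b = 0" for a b
  proof -
    have "partial k (\<lambda>z. \<Sum>c\<in>UNIV. ginv z $ a $ c * g z $ c $ b) y = partial k (\<lambda>z. (mat 1 :: real^'n^'n) $ a $ b) y"
    proof (rule partial_cong[of "- {0}"])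
      show "(\<Sum>c\<in>UNIV. ginv z $ a $ c * g z $ c $ b) = (mat 1 :: real^'n^'n) $ a $ b" if "z \<in> - {0}" for z
        using arg_cong[OF pos_def_matrix_invertible(1)[OF pos_def, of z], of "\<lambda>B. B $ a $ b"] that
        by (simp add: matrix_matrix_mult_def)
      show "(\<lambda>z. \<Sum>c\<in>UNIV. ginv z $ a $ c * g z $ c $ b) differentiable at y"
        by (intro punctured_differentiable y smooth_on_sum smooth_on_mult smooth_g smooth_ginv) auto
    qed (use y in auto)
    also have "partial k (\<lambda>z. \<Sum>c\<in>UNIV. ginv z $ a $ c * g z $ c $ b) y = (dP ** g y + ginv y ** dg k y) $ a $ b"
      by (subst partial_sum)
         (auto simp: partial_mult punctured_differentiable smooth_g smooth_ginv smooth_on_mult y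
            dP_def dg_def matrix_matrix_mult_def sum.distrib)
    finally show ?thesis by (simp add: partial_const)
  qed
  then have "dP ** g y + ginv y ** dg k y = 0" by (simp add: vec_eq_iff)
  then have "(dP ** g y + ginv y ** dg k y) ** ginv y = 0" by simp
  then have "dP ** (g y ** ginv y) + ginv y ** dg k y ** ginv y = 0"
    by (simp add: matrix_matrix_mult_add_left matrix_mul_assoc)
  then have "dP = - (ginv y ** dg k y ** ginv y)"
    using pos_def_matrix_invertible(2)[OF pos_def[OF y]] by (simp add: add_eq_0_iff2)
  then show ?thesis by (simp add: dP_def vec_eq_iff)
qed

end

text \<open>The mean Cartan torsion is half the trace of \<open>dg\<close>.\<close>

locale mean_Cartan_zero = minkowski_norm u g for u :: "real^'n::finite \<Rightarrow> real" and g +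
  assumes trace_dg: "\<And>k y. y \<noteq> 0 \<Longrightarrow> (\<Sum>i\<in>UNIV. \<Sum>j\<in>UNIV. ginv y $ i $ j * dg k y $ i $ j) = 0"
begin

text \<open>After \<open>partial_ginv\<close>, total symmetry of \<open>dg\<close> lets the
  differentiation index trade places with a matrix index. The sum then contains the trace of
  \<open>dg b y\<close>, which is zero by \<open>trace_dg\<close>.\<close>

lemma divergence_ginv:
  assumes y: "y \<noteq> 0"
  shows "(\<Sum>i\<in>UNIV. partial i (\<lambda>z. ginv z $ i $ j) y) = 0"
proof -
  have "(\<Sum>i\<in>UNIV. partial i (\<lambda>z. ginv z $ i $ j) y)
      = - (\<Sum>i\<in>UNIV. \<Sum>b\<in>UNIV. \<Sum>a\<in>UNIV. ginv y $ i $ a * dg b y $ i $ a * ginv y $ b $ j)"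
    by (simp add: partial_ginv[OF y] matrix_matrix_mult_def sum_distrib_right sum_negf
        dg_swap_first[OF y, of _ _ _] dg_swap_last[OF y])
  also have "(\<Sum>i\<in>UNIV. \<Sum>b\<in>UNIV. \<Sum>a\<in>UNIV. ginv y $ i $ a * dg b y $ i $ a * ginv y $ b $ j)
     = (\<Sum>b\<in>UNIV. (\<Sum>i\<in>UNIV. \<Sum>a\<in>UNIV. ginv y $ i $ a * dg b y $ i $ a) * ginv y $ b $ j)"
    by (subst sum.swap) (simp add: sum_distrib_right)
  finally show ?thesis by (simp add: trace_dg[OF y])
qed

text \<open>For fixed \<open>k\<close>, the gradient of the function \<open>g $ k $ k\<close> with
  respect to \<open>g\<close>: its differential with the index raised by
  \<open>ginv\<close>.\<close>

definition X :: "'n \<Rightarrow> 'n \<Rightarrow> real^'n \<Rightarrow> real" where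
  "X k i y = (\<Sum>j\<in>UNIV. ginv y $ i $ j * dg j y $ k $ k)"

lemma smooth_X: "smooth_on (- {0}) (X k i)"
  unfolding X_def[abs_def]
  by (intro smooth_on_sum smooth_on_mult smooth_ginv smooth_dg) auto

text \<open>The derivatives of \<open>ginv\<close> drop out by \<open>divergence_ginv\<close>. What
  remains is \<open>ginv\<close> contracted with second derivatives of \<open>g\<close>, and
  differentiating \<open>trace_dg\<close> expresses this through first derivatives.\<close>

lemma divergence_X:
  assumes y: "y \<noteq> 0"
  shows "(\<Sum>i\<in>UNIV. partial i (X k i) y) =
    (\<Sum>i\<in>UNIV. \<Sum>j\<in>UNIV. ginv y $ i $ j * (dg k y ** ginv y ** dg k y) $ i $ j)"
proof -
  note diff = punctured_differentiable[OF _ y]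
  \<comment> \<open>Both sides are half the fourth derivative of \<open>u\<close> in the indices
    \<open>i\<close>, \<open>j\<close>, \<open>k\<close>, \<open>k\<close>.\<close>
  have dd: "partial i (\<lambda>z. dg j z $ k $ k) y = partial k (\<lambda>z. dg k z $ i $ j) y" for i j
  proof -
    have "partial i (\<lambda>z. dg j z $ k $ k) y = partial i (\<lambda>z. dg k z $ k $ j) y"
      by (rule partial_cong[of "- {0}"])
         (use dg_swap_first dg_swap_last y in \<open>auto intro: diff smooth_dg\<close>)
    also have "\<dots> = partial k (\<lambda>z. dg i z $ k $ j) y"
      using partial_commute[OF open_Compl[OF closed_singleton] _ smooth_g, of y i k k j] y by (simp add: dg_def)
    also have "\<dots> = partial k (\<lambda>z. dg k z $ i $ j) y"
      by (rule partial_cong[of "- {0}"])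
         (use dg_swap_first y in \<open>auto intro: diff smooth_dg\<close>)
    finally show ?thesis .
  qed
  have "(\<Sum>i\<in>UNIV. partial i (X k i) y) =
     (\<Sum>i\<in>UNIV. \<Sum>j\<in>UNIV. partial i (\<lambda>z. ginv z $ i $ j) y * dg j y $ k $ k)
     + (\<Sum>i\<in>UNIV. \<Sum>j\<in>UNIV. ginv y $ i $ j * partial k (\<lambda>z. dg k z $ i $ j) y)"
    unfolding X_def[abs_def]
    by (simp add: partial_sum partial_mult diff smooth_ginv smooth_dg smooth_on_mult dd sum.distrib)
  also have "(\<Sum>i\<in>UNIV. \<Sum>j\<in>UNIV. partial i (\<lambda>z. ginv z $ i $ j) y * dg j y $ k $ k) = 0"
    by (subst sum.swap) (simp add: divergence_ginv[OF y] flip: sum_distrib_right)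
  finally have 1: "(\<Sum>i\<in>UNIV. partial i (X k i) y) =
    (\<Sum>i\<in>UNIV. \<Sum>j\<in>UNIV. ginv y $ i $ j * partial k (\<lambda>z. dg k z $ i $ j) y)" by simp
  \<comment> \<open>The product rule on the vanishing trace trades second derivatives of
    \<open>g\<close> for derivatives of \<open>ginv\<close>, hence for an expression quadratic in
    \<open>dg\<close>.\<close>
  have "partial k (\<lambda>z. \<Sum>i\<in>UNIV. \<Sum>j\<in>UNIV. ginv z $ i $ j * dg k z $ i $ j) y = partial k (\<lambda>_. 0) y"
    by (rule partial_cong[of "- {0}"])
       (use y trace_dg in \<open>auto intro!: diff smooth_on_sum smooth_on_mult smooth_ginv smooth_dg\<close>)
  also have "partial k (\<lambda>z. \<Sum>i\<in>UNIV. \<Sum>j\<in>UNIV. ginv z $ i $ j * dg k z $ i $ j) y =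
     (\<Sum>i\<in>UNIV. \<Sum>j\<in>UNIV. partial k (\<lambda>z. ginv z $ i $ j) y * dg k y $ i $ j)
     + (\<Sum>i\<in>UNIV. \<Sum>j\<in>UNIV. ginv y $ i $ j * partial k (\<lambda>z. dg k z $ i $ j) y)"
    by (simp add: partial_sum partial_mult diff smooth_ginv smooth_dg smooth_on_mult smooth_on_sum sum.distrib)
  finally have "(\<Sum>i\<in>UNIV. \<Sum>j\<in>UNIV. ginv y $ i $ j * partial k (\<lambda>z. dg k z $ i $ j) y)
     = (\<Sum>i\<in>UNIV. \<Sum>j\<in>UNIV. (ginv y ** dg k y ** ginv y) $ i $ j * dg k y $ i $ j)"
    by (simp add: partial_ginv[OF y] partial_const sum_negf)
  also have "\<dots> = trace (ginv y ** (dg k y ** ginv y ** dg k y))"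
    by (simp add: trace_mult_symmetric[OF dg_symmetric[OF y], symmetric] matrix_mul_assoc)
  also have "\<dots> = (\<Sum>i\<in>UNIV. \<Sum>j\<in>UNIV. ginv y $ i $ j * (dg k y ** ginv y ** dg k y) $ i $ j)"
    using psd_congruence(1)[OF pos_def_matrix_imp_psd[OF pos_def_matrix_inv[OF pos_def[OF y]]] dg_symmetric[OF y]]
    by (intro trace_mult_symmetric) (simp add: psd_matrix_def)
  finally show ?thesis using 1 by simp
qed

text \<open>Raising the index of the differential \<open>2 * (g y *v y)\<close> of \<open>u\<close>
  gives \<open>2 * y\<close>, and \<open>g $ k $ k\<close> is constant along rays. Hence the
  derivative of the cut-off adds nothing to the divergence.\<close>

lemma X_tangential:
  assumes y: "y \<noteq> 0"
  shows "(\<Sum>i\<in>UNIV. partial i u y * X k i y) = 0"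
proof -
  have inv: "ginv y *v (g y *v y) = y"
    using pos_def_matrix_invertible(1)[OF pos_def[OF y]] by (simp add: matrix_vector_mul_assoc)
  have sym: "ginv y $ i $ j = ginv y $ j $ i" for i j
    by (rule pos_def_matrix_symmetric[OF pos_def_matrix_inv[OF pos_def[OF y]]])
  have "(\<Sum>i\<in>UNIV. partial i u y * X k i y)
    = (\<Sum>i\<in>UNIV. \<Sum>j\<in>UNIV. 2 * (ginv y $ j $ i * (g y *v y) $ i) * dg j y $ k $ k)"
    by (simp add: partial_u[OF y] X_def sum_distrib_left mult_ac sym[of _ _])
  also have "\<dots> = (\<Sum>j\<in>UNIV. 2 * (ginv y *v (g y *v y)) $ j * dg j y $ k $ k)"
    by (subst sum.swap) (simp add: matrix_vector_mult_def[of "ginv y"] sum_distrib_left sum_distrib_right)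
  also have "\<dots> = 2 * (\<Sum>j\<in>UNIV. y $ j * dg j y $ k $ k)"
    by (simp add: inv sum_distrib_left mult.assoc)
  finally show ?thesis by (simp add: dg_radial[OF y])
qed

theorem Deicke:
  assumes y: "y \<noteq> 0"
  shows "dg k y = 0"
proof -
  obtain m B where mB: "0 < m" "0 < B" "\<And>y. y \<noteq> 0 \<Longrightarrow> m * (norm y)\<^sup>2 \<le> u y"
    "\<And>y. y \<noteq> 0 \<Longrightarrow> u y \<le> B * (norm y)\<^sup>2"
    by (rule u_bounds) blast
  define W where "W i y = (if y = 0 then 0 else bump (u y) * X k i y)" for i y
  define b' where "b' s = 2 * max 0 ((s - 1) * (2 - s)) * (3 - 2 * s)" for s :: real
  note diff = punctured_differentiable
  have cu: "(\<lambda>y. bump (u y)) differentiable (at y)" "partial i (\<lambda>y. bump (u y)) y = b' (u y) * partial i u y"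
    if "y \<noteq> 0" for y i
    using partial_compose_real[OF DERIV_bump diff[OF smooth that]] by (simp_all add: b'_def)
  have W1: "W i differentiable (at y)"
      "partial i (W i) y = b' (u y) * (partial i u y * X k i y) + bump (u y) * partial i (X k i) y"
    if y: "y \<noteq> 0" for y i
  proof -
    have d: "(\<lambda>y. bump (u y) * X k i y) differentiable (at y)"
      by (intro differentiable_mult cu diff[OF smooth_X] y)
    have eq: "bump (u z) * X k i z = W i z" if "z \<in> - {0}" for z
      using that by (simp add: W_def)
    show "W i differentiable (at y)"
      using has_derivative_transform_within_open[OF differentiable_has_derivative[OF d], of "- {0}" "W i"] eq y
      by (auto simp: differentiable_def)
    have "partial i (W i) y = partial i (\<lambda>y. bump (u y) * X k i y) y"
      by (rule partial_cong[of "- {0}", symmetric]) (use eq y d in auto)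
    then show "partial i (W i) y = b' (u y) * (partial i u y * X k i y) + bump (u y) * partial i (X k i) y"
      by (simp add: partial_mult cu diff[OF smooth_X] y)
  qed
  have W2: "continuous_on (- {0}) (partial i (W i))" for i
  proof -
    note cont = smooth_on_continuous_on
    have "continuous_on (- {0}) (\<lambda>y. b' (u y) * (partial i u y * X k i y) + bump (u y) * partial i (X k i) y)"
      unfolding b'_def bump_def
      by (intro continuous_intros cont[OF smooth] cont[OF smooth_X] cont[OF smooth_on_partial[OF smooth]]
          cont[OF smooth_on_partial[OF smooth_X]])
    then show ?thesis by (rule continuous_on_eq) (simp add: W1)
  qed
  \<comment> \<open>The bound \<open>1\<close> gives \<open>(norm y)^2 \<le> norm y\<close>, and
    then \<open>1 / B\<close> forces \<open>u y \<le> 1\<close>, where \<open>bump\<close>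
    vanishes.\<close>
  have small: "W i y = 0" if "norm y < min 1 (1 / B)" for y i
  proof (cases "y = 0")
    case False
    have "norm y * norm y \<le> norm y * 1" using that by (intro mult_left_mono) auto
    then have "B * (norm y)\<^sup>2 \<le> B * norm y" using mB(2) by (simp add: power2_eq_square)
    also have "\<dots> \<le> 1" using that mB(2) by (simp add: field_simps)
    finally show ?thesis using mB(4)[OF False] by (simp add: W_def bump_eq_0)
  qed (simp add: W_def)
  \<comment> \<open>Likewise \<open>(norm y)^2 \<ge> norm y\<close> here, and \<open>2 / m\<close>
    forces \<open>u y \<ge> 2\<close>, again outside the support of \<open>bump\<close>.\<close>
  have large: "W i y = 0" if "norm y > max 1 (2 / m)" for y i
  proof -
    have y: "y \<noteq> 0" using that by auto
    have "norm y * 1 \<le> norm y * norm y" using that by (intro mult_left_mono) auto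
    then have "m * norm y \<le> m * (norm y)\<^sup>2" using mB(1) by (simp add: power2_eq_square)
    moreover have "2 \<le> m * norm y" using that mB(1) by (simp add: field_simps)
    ultimately show ?thesis using mB(3)[OF y] by (simp add: W_def bump_eq_0)
  qed
  have r: "min 1 (1 / B) > 0" using mB by simp
  have W3: "W i differentiable (at y)" "continuous_on UNIV (partial i (W i))" for i y
    using extend_by_zero[OF W1(1) W2 r small] by auto
  let ?L = "\<lambda>y. \<Sum>i\<in>UNIV. \<Sum>j\<in>UNIV. ginv y $ i $ j * (dg k y ** ginv y ** dg k y) $ i $ j"
  have div: "(\<Sum>i\<in>UNIV. partial i (W i) y) = bump (u y) * ?L y" if "y \<noteq> 0" for y
    using that X_tangential[OF that, of k] divergence_X[OF that, of k]
    by (simp add: W1 sum.distrib flip: sum_distrib_left)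
  have L: "0 \<le> ?L y" if "y \<noteq> 0" for y
    using pos_def_matrix_imp_psd[OF pos_def_matrix_inv[OF pos_def[OF that]]]
    by (intro trace_psd_nonneg psd_congruence dg_symmetric that)
  have nn: "0 \<le> (\<Sum>i\<in>UNIV. partial i (W i) y)" for y
  proof (cases "y = 0")
    case True
    have "partial i (W i) 0 = partial i (\<lambda>_. 0) 0" for i
      by (rule partial_cong[of "ball 0 (min 1 (1 / B))"]) (use small r W3 in auto)
    then show ?thesis by (simp add: True partial_const)
  next
    case False
    then show ?thesis using L[OF False] by (simp add: div bump_nonneg)
  qed
  have zero: "(\<Sum>i\<in>UNIV. partial i (W i) y) = 0" for y
    by (rule divergence_nonneg_imp_zero[OF W3 large nn])
  \<comment> \<open>Scales \<open>y\<close> to the level \<open>u = 3/2\<close>, where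
    \<open>bump\<close> is positive; \<open>dg_homogeneous\<close> brings the conclusion back to
    \<open>y\<close>.\<close>
  define t where "t = sqrt (3/2 / u y)"
  have t: "t > 0" using u_pos[OF y] by (simp add: t_def)
  have ty: "t *\<^sub>R y \<noteq> 0" using t y by simp
  have "u (t *\<^sub>R y) = 3/2" using homogeneous[OF t y] u_pos[OF y] by (simp add: t_def)
  then have "bump (u (t *\<^sub>R y)) \<noteq> 0" by (simp add: bump_def)
  then have "?L (t *\<^sub>R y) = 0" using div[OF ty] zero by simp
  then have "dg k (t *\<^sub>R y) = 0"
    by (rule trace_congruence_zero[OF pos_def_matrix_inv[OF pos_def[OF ty]] dg_symmetric[OF ty]])
  then show ?thesis using dg_homogeneous[OF t y, of k] by simp
qed

end

section \<open>AR-Finsler metrics\<close>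

lemma scaleR_matrix_mult:
  fixes A B :: "real^'n^'n::finite"
  shows "(c *\<^sub>R A) ** B = c *\<^sub>R (A ** B)" "A ** (c *\<^sub>R B) = c *\<^sub>R (A ** B)"
  by (simp_all add: vec_eq_iff matrix_matrix_mult_def sum_distrib_left mult_ac)

context minkowski_norm
begin

text \<open>Write \<open>\<alpha>\<close> as \<open>s\<close> times \<open>g\<close> with
  \<open>s = 1 / \<eta>\<close>. The derivatives of \<open>s\<close> contribute
  \<open>n * partial i s y\<close> once with each sign and cancel. By symmetry of \<open>dg\<close>
  the derivatives of \<open>g\<close> leave \<open>n - 1\<close> equal traces, and
  \<open>\<eta> * s = 1\<close> removes the factor.\<close>

lemma AR_condition_eq_trace_dg:
  assumes \<eta>: "smooth_on (- {0}) \<eta>"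
    and g: "\<And>y. y \<noteq> 0 \<Longrightarrow> g y = \<eta> y *\<^sub>R \<alpha> y"
    and \<alpha>: "\<And>y. y \<noteq> 0 \<Longrightarrow> pos_def_matrix (\<alpha> y)" and y: "y \<noteq> 0"
  shows "(\<Sum>j\<in>UNIV. \<Sum>k\<in>UNIV. matrix_inv (\<alpha> y) $ j $ k *
      (real CARD('n) * partial k (\<lambda>z. \<alpha> z $ j $ i) y - partial i (\<lambda>z. \<alpha> z $ j $ k) y))
    = (real CARD('n) - 1) * (\<Sum>j\<in>UNIV. \<Sum>k\<in>UNIV. ginv y $ j $ k * dg i y $ j $ k)"
proof -
  let ?n = "real CARD('n)" and ?P = "ginv y"
  define s where "s z = inverse (\<eta> z)" for z
  \<comment> \<open>A zero of \<open>\<eta>\<close> would make \<open>g\<close> vanish, and with it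
    \<open>u\<close>, against \<open>u_pos\<close>.\<close>
  have \<eta>0: "\<eta> z \<noteq> 0" if "z \<noteq> 0" for z
  proof
    assume "\<eta> z = 0"
    then have "g z = 0" using g[OF that] by simp
    then show False using u_pos[OF that] u_eq[OF that] by simp
  qed
  have \<alpha>s: "\<alpha> z = s z *\<^sub>R g z" if "z \<noteq> 0" for z
    using g[OF that] \<eta>0[OF that] by (simp add: s_def)
  have ss: "smooth_on (- {0}) s"
    unfolding s_def[abs_def] by (intro smooth_on_inverse \<eta>) (auto simp: \<eta>0)
  note diff = punctured_differentiable[OF _ y]
  have d\<alpha>: "partial k (\<lambda>z. \<alpha> z $ i $ j) y = partial k s y * g y $ i $ j + s y * dg k y $ i $ j" for i j k
  proof -
    have "partial k (\<lambda>z. \<alpha> z $ i $ j) y = partial k (\<lambda>z. s z * g z $ i $ j) y"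
      by (rule partial_cong[of "- {0}", symmetric])
         (use y \<alpha>s in \<open>auto intro!: diff smooth_on_mult ss smooth_g\<close>)
    then show ?thesis by (simp add: partial_mult diff ss smooth_g dg_def)
  qed
  have "matrix_inv (\<alpha> y) = matrix_inv (\<alpha> y) ** (g y ** ?P)"
    using pos_def_matrix_invertible[OF pos_def[OF y]] by simp
  also have "\<dots> = \<eta> y *\<^sub>R ((matrix_inv (\<alpha> y) ** \<alpha> y) ** ?P)"
    by (simp add: g[OF y] scaleR_matrix_mult matrix_mul_assoc)
  finally have inv: "matrix_inv (\<alpha> y) = \<eta> y *\<^sub>R ?P"
    using pos_def_matrix_invertible[OF \<alpha>[OF y]] by simp
  have Pg: "(\<Sum>j\<in>UNIV. ?P $ j $ k * g y $ j $ i) = (if k = i then 1 else 0)" for k i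
    using arg_cong[OF pos_def_matrix_invertible(1)[OF pos_def[OF y]], of "\<lambda>B. B $ k $ i"]
      pos_def_matrix_symmetric[OF pos_def_matrix_inv[OF pos_def[OF y]], of k]
    by (simp add: matrix_matrix_mult_def mat_def)
  have 1: "(\<Sum>j\<in>UNIV. \<Sum>k\<in>UNIV. ?P $ j $ k * (partial k s y * g y $ j $ i)) = partial i s y"
  proof -
    have "(\<Sum>j\<in>UNIV. \<Sum>k\<in>UNIV. ?P $ j $ k * (partial k s y * g y $ j $ i))
      = (\<Sum>k\<in>UNIV. partial k s y * (\<Sum>j\<in>UNIV. ?P $ j $ k * g y $ j $ i))"
      by (subst sum.swap) (simp add: sum_distrib_left mult_ac)
    then show ?thesis by (simp add: Pg if_distrib sum.delta cong: if_cong)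
  qed
  have 2: "(\<Sum>j\<in>UNIV. \<Sum>k\<in>UNIV. ?P $ j $ k * (partial i s y * g y $ j $ k)) = ?n * partial i s y"
  proof -
    have "(\<Sum>j\<in>UNIV. \<Sum>k\<in>UNIV. ?P $ j $ k * (partial i s y * g y $ j $ k))
      = partial i s y * (\<Sum>k\<in>UNIV. \<Sum>j\<in>UNIV. ?P $ j $ k * g y $ j $ k)"
      by (subst sum.swap) (simp add: sum_distrib_left mult_ac)
    then show ?thesis by (simp add: Pg)
  qed
  have sym: "dg k y $ j $ i = dg i y $ j $ k" for j k
    using dg_swap_first[OF y, of k i j] dg_swap_last[OF y] by metis
  have "(\<Sum>j\<in>UNIV. \<Sum>k\<in>UNIV. matrix_inv (\<alpha> y) $ j $ k *
      (?n * partial k (\<lambda>z. \<alpha> z $ j $ i) y - partial i (\<lambda>z. \<alpha> z $ j $ k) y))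
    = \<eta> y * (?n * (\<Sum>j\<in>UNIV. \<Sum>k\<in>UNIV. ?P $ j $ k * (partial k s y * g y $ j $ i))
        - (\<Sum>j\<in>UNIV. \<Sum>k\<in>UNIV. ?P $ j $ k * (partial i s y * g y $ j $ k))
        + (?n - 1) * s y * (\<Sum>j\<in>UNIV. \<Sum>k\<in>UNIV. ?P $ j $ k * dg i y $ j $ k))"
    by (simp add: inv d\<alpha> sym sum_distrib_left sum_subtractf[symmetric] sum.distrib[symmetric] algebra_simps)
  then show ?thesis using \<eta>0[OF y] by (simp add: 1 2 s_def)
qed

text \<open>The punctured space is connected from dimension two on, so functions with zero
  derivative are constant there.\<close>

lemma g_const:
  assumes dim: "CARD('n) \<ge> 2" and dg: "\<And>k y. y \<noteq> 0 \<Longrightarrow> dg k y = 0"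
    and y: "y \<noteq> 0" "z \<noteq> 0"
  shows "g y = g z"
proof -
  have "g y $ i $ j = g z $ i $ j" for i j
  proof (rule has_derivative_zero_unique_connected[of "- {0}" "\<lambda>y. g y $ i $ j"])
    show "connected (- {0::real^'n})"
      using connected_punctured_universe[of "0::real^'n"] dim by simp
    fix x :: "real^'n" assume x: "x \<in> - {0}"
    have d: "(\<lambda>y. g y $ i $ j) differentiable at x"
      using x by (auto intro: punctured_differentiable smooth_g)
    have "partial k (\<lambda>y. g y $ i $ j) x = 0" for k
      using arg_cong[OF dg[of x k], of "\<lambda>B. B $ i $ j"] x by (simp add: dg_def)
    then have "frechet_derivative (\<lambda>y. g y $ i $ j) (at x) = (\<lambda>_. 0)"
      using frechet_derivative_eq_sum_partial[OF d] by (simp add: fun_eq_iff)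
    then show "((\<lambda>y. g y $ i $ j) has_derivative (\<lambda>_. 0)) (at x)"
      using differentiable_has_derivative[OF d] by simp
  qed (use y in auto)
  then show ?thesis by (simp add: vec_eq_iff)
qed

text \<open>A quadratic form has constant Hessian. This is the fibrewise content of the direction
  from Riemannian to vanishing torsion.\<close>

lemma quadratic_imp_dg_zero:
  assumes u: "\<And>y. u y = y \<bullet> (H *v y)" and H: "transpose H = H"
  shows "dg k y = 0"
proof -
  have lin: "bounded_linear ((*v) H)" by (simp add: matrix_vector_mul_bounded_linear)
  have "partial j u z = 2 * (H *v z) $ j" for j z
  proof -
    have "(u has_derivative (\<lambda>v. z \<bullet> (H *v v) + v \<bullet> (H *v z))) (at z)"
      unfolding u[abs_def]
      by (intro has_derivative_inner has_derivative_ident bounded_linear_imp_has_derivative lin)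
    then show ?thesis
      using inner_symmetric_matrix[OF H, of z "axis j 1"]
      by (simp add: partial_eqI inner_axis inner_axis')
  qed
  then have pu: "partial j u = (\<lambda>z. 2 * (H *v z) $ j)" for j by auto
  have "partial i (\<lambda>z. 2 * (H *v z) $ j) z = 2 * H $ j $ i" for i j z
  proof -
    have "((\<lambda>z. 2 * (H *v z) $ j) has_derivative (\<lambda>v. 2 * (H *v v) $ j)) (at z)"
      by (intro bounded_linear_imp_has_derivative bounded_linear_const_mult
            bounded_linear_compose[OF bounded_linear_vec_nth lin])
    then show ?thesis by (simp add: partial_eqI matrix_vector_mul_component inner_axis)
  qed
  then show ?thesis by (simp add: dg_def g_nth pu partial_const vec_eq_iff)
qed

end

section \<open>Tangent vectors in chart coordinates\<close>

lemma transition_chart_inv_differentiable: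
  assumes M: "smooth_manifold M A" and c: "c \<in> A" "x \<in> chart_image c" and d: "d \<in> A" "chart_inv c x \<in> fst d"
  shows "transition c d differentiable (at x)"
  using transition_differentiable[OF M c(1) d(1) inv_into_into[OF c(2)] d(2)] f_inv_into_f[OF c(2)] by simp

text \<open>Meant for tangent vectors with a common base point, which is read off the first
  argument.\<close>

definition add_tvector :: "('m, 'n::finite) tvector \<Rightarrow> ('m, 'n) tvector \<Rightarrow> ('m, 'n) tvector" where
  "add_tvector v w = (fst v, \<lambda>c. snd v c + snd w c)"

text \<open>Components in the other charts come from derivatives of transition maps, which are
  linear.\<close>

lemma tvec_linear:
  assumes M: "smooth_manifold M A" and c: "c \<in> A" "x \<in> chart_image c"
  shows "tvec A c x (y + z) = add_tvector (tvec A c x y) (tvec A c x z)"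
    and "tvec A c x (t *\<^sub>R y) = scale_tvector t (tvec A c x y)"
proof -
  have lin: "linear (frechet_derivative (transition c d) (at x))" if "d \<in> A \<and> chart_inv c x \<in> fst d" for d
    using transition_chart_inv_differentiable[OF M c] that linear_frechet_derivative by blast
  show "tvec A c x (y + z) = add_tvector (tvec A c x y) (tvec A c x z)"
    using linear_add[OF lin] by (auto simp: tvec_def add_tvector_def fun_eq_iff)
  show "tvec A c x (t *\<^sub>R y) = scale_tvector t (tvec A c x y)"
    using linear_scale[OF lin] by (auto simp: tvec_def scale_tvector_def fun_eq_iff)
qed

lemma smooth_on_slice_snd:
  assumes "open T" "x \<in> S" "smooth_on (S \<times> T) (\<lambda>(x, y). f x y)"
  shows "smooth_on T (f x)"
proof -
  have "bounded_linear (\<lambda>y. (0, y))"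
    by (intro bounded_linear_Pair bounded_linear_zero bounded_linear_ident)
  from smooth_on_affine_compose[OF assms(1) this assms(3), of "(x, 0)"] assms(2)
  show ?thesis by simp
qed

lemma smooth_on_slice_fst:
  assumes "open S" "y \<in> T" "smooth_on (S \<times> T) (\<lambda>(x, y). f x y)"
  shows "smooth_on S (\<lambda>x. f x y)"
proof -
  have "bounded_linear (\<lambda>x. (x, 0))"
    by (intro bounded_linear_Pair bounded_linear_zero bounded_linear_ident)
  from smooth_on_affine_compose[OF assms(1) this assms(3), of "(0, y)"] assms(2)
  show ?thesis by simp
qed

text \<open>A matrix is the sum of its entries times fixed matrix units.\<close>

lemma smooth_on_matrix:
  fixes B :: "'a::real_normed_vector \<Rightarrow> real^'n^'n::finite"
  assumes S: "open S" and B: "\<And>i j. smooth_on S (\<lambda>x. B x $ i $ j)"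
  shows "smooth_on S B"
proof -
  have "smooth_on S (\<lambda>x. \<Sum>i\<in>UNIV. \<Sum>j\<in>UNIV. B x $ i $ j *\<^sub>R (axis i (axis j 1) :: real^'n^'n))"
    by (intro smooth_on_sum S smooth_on_bounded_linear[OF S bounded_linear_scaleR_left B])
  moreover have "(\<Sum>i\<in>UNIV. \<Sum>j\<in>UNIV. B x $ i $ j *\<^sub>R axis i (axis j 1)) = B x" for x
  proof -
    have "(B x $ i $ j *\<^sub>R axis i (axis j 1 :: real^'n) :: real^'n^'n) $ a $ b =
        (if j = b then if i = a then B x $ i $ j else 0 else 0)" for i j a b
      by (auto simp: axis_def)
    then show ?thesis
      unfolding vec_eq_iff sum_component by simp
  qed
  ultimately show ?thesis by simp
qed

section \<open>Finsler metrics on the manifold, one fibre at a time\<close>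

context
  fixes M :: "'m topology" and A :: "('m, 'n::finite) chart set" and F :: "('m, 'n) tvector \<Rightarrow> real"
  assumes M: "smooth_manifold M A" and F: "finsler_metric M A F"
begin

lemma open_chart_image: "c \<in> A \<Longrightarrow> open (chart_image c)"
  using M unfolding smooth_manifold_def is_chart_def by blast

lemma finsler_squared_smooth:
  assumes "c \<in> A"
  shows "smooth_on (chart_image c \<times> (- {0})) (\<lambda>(x, y). (F (tvec A c x y))\<^sup>2)"
proof -
  have "smooth_on (chart_image c \<times> (- {0})) (\<lambda>(x, y). F (tvec A c x y))"
    using F assms unfolding finsler_metric_def smooth_on_slit_TM_def by blast
  from smooth_on_mult[OF open_Times[OF open_chart_image[OF assms] open_Compl[OF closed_singleton]] this this]
  show ?thesis by (simp add: power2_eq_square case_prod_unfold)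
qed

lemma finsler_homogeneous:
  assumes "c \<in> A" "x \<in> chart_image c" "t > 0"
  shows "F (tvec A c x (t *\<^sub>R y)) = t * F (tvec A c x y)"
  using F tvec_in_TM(1)[OF M assms(1,2)] assms(3)
  by (simp add: tvec_linear(2)[OF M assms(1,2)] finsler_metric_def)

text \<open>Slicing at a fixed \<open>x\<close> turns the conditions on the manifold into those on
  one tangent space, so that \<open>Deicke\<close> can be applied fibrewise.\<close>

lemma finsler_minkowski_norm:
  assumes c: "c \<in> A" "x \<in> chart_image c"
  shows "minkowski_norm (\<lambda>y. (F (tvec A c x y))\<^sup>2) (fund_tensor A F c x)"
proof
  show "fund_tensor A F c x = (\<lambda>y. \<chi> i j. 1 / 2 * partial i (partial j (\<lambda>y. (F (tvec A c x y))\<^sup>2)) y)"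
    by (simp add: fund_tensor_def fun_eq_iff)
  show "smooth_on (- {0}) (\<lambda>y. (F (tvec A c x y))\<^sup>2)"
    using smooth_on_slice_snd[OF _ c(2) finsler_squared_smooth[OF c(1)]] by auto
  show "(F (tvec A c x (t *\<^sub>R y)))\<^sup>2 = t\<^sup>2 * (F (tvec A c x y))\<^sup>2" if "t > 0" for t y
    using finsler_homogeneous[OF c that] by (simp add: power_mult_distrib)
  show "pos_def_matrix (fund_tensor A F c x y)" if "y \<noteq> 0" for y
    using F c that unfolding finsler_metric_def by blast
qed

lemma is_riemannian_imp_dg_zero:
  assumes "is_riemannian M A F" and c: "c \<in> A" "x \<in> chart_image c"
  shows "minkowski_norm.dg (fund_tensor A F c x) k y = 0"
proof -
  interpret minkowski_norm "\<lambda>y. (F (tvec A c x y))\<^sup>2" "fund_tensor A F c x"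
    by (rule finsler_minkowski_norm[OF c])
  obtain h where h: "riemannian_metric A h" "\<And>v. v \<in> TM M A \<Longrightarrow> F v = sqrt (h v v)"
    using assms(1) unfolding is_riemannian_def by blast
  obtain H where H: "pos_def_matrix H" "\<And>y z. h (tvec A c x y) (tvec A c x z) = y \<bullet> (H *v z)"
    using h(1) c unfolding riemannian_metric_def by blast
  show ?thesis
  proof (rule quadratic_imp_dg_zero)
    show "(F (tvec A c x y))\<^sup>2 = y \<bullet> (H *v y)" for y
      using h(2)[OF tvec_in_TM(1)[OF M c]] pos_def_matrix_imp_psd[OF H(1)]
      by (simp add: H(2) psd_matrix_def)
    show "transpose H = H" using H(1) by (simp add: pos_def_matrix_def)
  qed
qed

text \<open>\<open>h\<close> is obtained from \<open>F\<^sup>2\<close> by polarisation, which needs no choice of charts.\<close>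

lemma fund_tensor_const_imp_is_riemannian:
  assumes const: "\<And>c x y z. c \<in> A \<Longrightarrow> x \<in> chart_image c \<Longrightarrow> y \<noteq> 0 \<Longrightarrow> z \<noteq> 0 \<Longrightarrow>
    fund_tensor A F c x y = fund_tensor A F c x z"
  shows "is_riemannian M A F"
proof -
  define h where "h v w = ((F (add_tvector v w))\<^sup>2 - (F v)\<^sup>2 - (F w)\<^sup>2) / 2" for v w
  \<comment> \<open>An arbitrary nonzero direction at which to evaluate the fundamental tensor,
    which by assumption does not depend on the direction.\<close>
  define y0 :: "real^'n" where "y0 = axis undefined 1"
  have y0: "y0 \<noteq> 0" by (simp add: y0_def axis_eq_0_iff)
  have metric: "F v = sqrt (h v v)" if v: "v \<in> TM M A" for v
  proof -
    have "add_tvector v v = scale_tvector 2 v"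
      by (simp add: add_tvector_def scale_tvector_def scaleR_2)
    then have "F (add_tvector v v) = 2 * F v" "0 \<le> F v"
      using F v by (simp_all add: finsler_metric_def)
    then show ?thesis by (simp add: h_def power_mult_distrib)
  qed
  have "\<exists>H. smooth_on (chart_image c) H \<and> (\<forall>x\<in>chart_image c. pos_def_matrix (H x) \<and>
           (\<forall>y z. h (tvec A c x y) (tvec A c x z) = y \<bullet> (H x *v z)))" if c: "c \<in> A" for c
  proof -
    define H where "H x = fund_tensor A F c x y0" for x
    have pd: "pos_def_matrix (H x)" if "x \<in> chart_image c" for x
      using F c that y0 unfolding finsler_metric_def H_def by blast
    have q: "(F (tvec A c x y))\<^sup>2 = y \<bullet> (H x *v y)" if x: "x \<in> chart_image c" for x y
    proof (cases "y = 0")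
      case True
      \<comment> \<open>The zero vector equals its own double, so homogeneity forces
        \<open>F\<close> to vanish on it.\<close>
      have "F (tvec A c x (2 *\<^sub>R 0)) = 2 * F (tvec A c x 0)"
        by (rule finsler_homogeneous[OF c x]) simp
      then show ?thesis by (simp add: True)
    next
      case False
      interpret minkowski_norm "\<lambda>y. (F (tvec A c x y))\<^sup>2" "fund_tensor A F c x"
        by (rule finsler_minkowski_norm[OF c x])
      show ?thesis using u_eq[OF False] const[OF c x False y0] by (simp add: H_def)
    qed
    have form: "h (tvec A c x y) (tvec A c x z) = y \<bullet> (H x *v z)" if x: "x \<in> chart_image c" for x y z
    proof -
      have "z \<bullet> (H x *v y) = y \<bullet> (H x *v z)"
        using inner_symmetric_matrix[of "H x" z y] pd[OF x] by (simp add: pos_def_matrix_def inner_commute)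
      then show ?thesis
        by (simp add: h_def q[OF x] matrix_vector_right_distrib inner_add_left inner_add_right
            flip: tvec_linear(1)[OF M c x])
    qed
    have "smooth_on (chart_image c) (\<lambda>x. H x $ i $ j)" for i j
    proof -
      note op = open_chart_image[OF c]
      have sl: "smooth_on (chart_image c) (\<lambda>x. (F (tvec A c x y))\<^sup>2)" if "y \<noteq> 0" for y
        using smooth_on_slice_fst[OF op _ finsler_squared_smooth[OF c], of y] that by simp
      \<comment> \<open>\<open>F^2\<close> is known to be smooth only in nonzero directions, so
        polarisation on the coordinate axes has to avoid the zero vector.\<close>
      have ne: "axis i 1 + axis j 1 \<noteq> (0 :: real^'n)"
      proof
        assume "axis i 1 + axis j 1 = (0 :: real^'n)"
        then have "(axis i 1 + axis j 1 :: real^'n) $ i = 0" by simp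
        then show False by (simp add: axis_def split: if_splits)
      qed
      have "smooth_on (chart_image c) (\<lambda>x. 1/2 * ((F (tvec A c x (axis i 1 + axis j 1)))\<^sup>2
          + (-1) * (F (tvec A c x (axis i 1)))\<^sup>2 + (-1) * (F (tvec A c x (axis j 1)))\<^sup>2))"
        by (intro smooth_on_mult smooth_on_add smooth_on_const op sl ne) (simp_all add: axis_eq_0_iff)
      then show ?thesis
      proof (rule smooth_on_cong[OF op, rotated])
        fix x assume x: "x \<in> chart_image c"
        show "1/2 * ((F (tvec A c x (axis i 1 + axis j 1)))\<^sup>2
          + (-1) * (F (tvec A c x (axis i 1)))\<^sup>2 + (-1) * (F (tvec A c x (axis j 1)))\<^sup>2) = H x $ i $ j"
          using form[OF x, of "axis i 1" "axis j 1"]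
          by (simp add: h_def quadratic_form_axis inner_axis flip: tvec_linear(1)[OF M c x])
      qed
    qed
    then have "smooth_on (chart_image c) H"
      by (rule smooth_on_matrix[OF open_chart_image[OF c]])
    with pd form show ?thesis by blast
  qed
  then have "riemannian_metric A h" by (simp add: riemannian_metric_def)
  with metric show ?thesis unfolding is_riemannian_def by blast
qed

end

section \<open>Riemannian metrics among the AR-Finsler metrics\<close>

theorem corollary3p11:
  fixes M :: "'m topology"
    and A :: "('m, 'n::finite) chart set"
    and F \<eta> :: "('m, 'n) tvector \<Rightarrow> real"
    and a :: "('m, 'n) chart \<Rightarrow> real^'n \<Rightarrow> real^'n \<Rightarrow> real^'n^'n"
  assumes "smooth_manifold M A"
    and "CARD('n) \<ge> 2"
    and "finsler_metric M A F"
    and "AR_decomposition M A F \<eta> a"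
  shows "is_riemannian M A F \<longleftrightarrow>
    (\<forall>c\<in>A. \<forall>x\<in>chart_image c. \<forall>y. y \<noteq> 0 \<longrightarrow> (\<forall>i.
      (\<Sum>j\<in>UNIV. \<Sum>k\<in>UNIV. matrix_inv (a c x y) $ j $ k *
         (real CARD('n) * partial k (\<lambda>z. a c x z $ j $ i) y - partial i (\<lambda>z. a c x z $ j $ k) y)) = 0))"
  (is "_ \<longleftrightarrow> (\<forall>c\<in>A. \<forall>x\<in>chart_image c. \<forall>y. y \<noteq> 0 \<longrightarrow> (\<forall>i. ?T c x y i = 0))")
proof -
  note mink = finsler_minkowski_norm[OF assms(1,3)]
  \<comment> \<open>Twice the mean Cartan torsion in the chart \<open>c\<close>.\<close>
  define I where "I c x y i = (\<Sum>j\<in>UNIV. \<Sum>k\<in>UNIV. matrix_inv (fund_tensor A F c x y) $ j $ k *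
      minkowski_norm.dg (fund_tensor A F c x) i y $ j $ k)" for c x y i
  have T: "?T c x y i = (real CARD('n) - 1) * I c x y i"
    if c: "c \<in> A" "x \<in> chart_image c" and y: "y \<noteq> 0" for c x y i
  proof -
    have \<eta>: "smooth_on (chart_image c \<times> (- {0})) (\<lambda>(x, y). \<eta> (tvec A c x y))"
      using assms(4) c(1) unfolding AR_decomposition_def smooth_on_slit_TM_def by blast
    show ?thesis
      unfolding I_def
    proof (rule minkowski_norm.AR_condition_eq_trace_dg[OF mink[OF c], of "\<lambda>y. \<eta> (tvec A c x y)" "a c x"])
      show "smooth_on (- {0}) (\<lambda>y. \<eta> (tvec A c x y))"
        using smooth_on_slice_snd[OF _ c(2) \<eta>] by auto
    qed (use assms(4) c y in \<open>auto simp: AR_decomposition_def\<close>)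
  qed
  have "is_riemannian M A F \<longleftrightarrow> (\<forall>c\<in>A. \<forall>x\<in>chart_image c. \<forall>y. y \<noteq> 0 \<longrightarrow> (\<forall>i. I c x y i = 0))"
  proof
    assume "is_riemannian M A F"
    from is_riemannian_imp_dg_zero[OF assms(1,3) this]
    show "\<forall>c\<in>A. \<forall>x\<in>chart_image c. \<forall>y. y \<noteq> 0 \<longrightarrow> (\<forall>i. I c x y i = 0)"
      unfolding I_def by simp
  next
    assume I: "\<forall>c\<in>A. \<forall>x\<in>chart_image c. \<forall>y. y \<noteq> 0 \<longrightarrow> (\<forall>i. I c x y i = 0)"
    show "is_riemannian M A F"
    proof (rule fund_tensor_const_imp_is_riemannian[OF assms(1,3)])
      fix c x and y z :: "real^'n"
      assume c: "c \<in> A" "x \<in> chart_image c" and yz: "y \<noteq> 0" "z \<noteq> 0"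
      interpret minkowski_norm "\<lambda>y. (F (tvec A c x y))\<^sup>2" "fund_tensor A F c x"
        by (rule mink[OF c])
      interpret mean_Cartan_zero "\<lambda>y. (F (tvec A c x y))\<^sup>2" "fund_tensor A F c x"
        by unfold_locales (rule I[unfolded I_def, rule_format, OF c])
      show "fund_tensor A F c x y = fund_tensor A F c x z"
        using g_const[OF assms(2) Deicke yz] .
    qed
  qed
  \<comment> \<open>The factor \<open>n - 1\<close> from \<open>T\<close> is nonzero in dimension at
    least two.\<close>
  moreover have "?T c x y i = 0 \<longleftrightarrow> I c x y i = 0"
    if "c \<in> A" "x \<in> chart_image c" "y \<noteq> 0" for c x y i
    unfolding T[OF that] using assms(2) by simp
  ultimately show ?thesis by blast
qed

end
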